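(* Let $\Sigma$ be a finite alphabet, let $X,Y\subseteq\Sigma^{\mathbb{Z}}$ be constrained systems, and let $\mu$ be a shift-invariant ergodic Borel probability measure on $Y$. Then \[R_0(X,Y,\mu)=\inf\{\nu(\{\mathbf{x}_0\ne\mathbf{y}_0\}):\nu\in M_{\mathcal{E}}(X,Y,\mu)\}=\inf\{\nu(\{\mathbf{x}_0\ne\mathbf{y}_0\}):\nu\in M(X,Y,\mu)\},\] where $\{\mathbf{x}_0\ne\mathbf{y}_0\}=\{(\mathbf{x},\mathbf{y})\in X\times Y:\mathbf{x}_0\ne\mathbf{y}_0\}$.
   Context: A constrained system is a set $X\subseteq\Sigma^{\mathbb{Z}}$ for which there is a finite directed graph with edges labeled by $\Sigma$ such that $X$ is the set of label sequences of bi-infinite directed paths. $T$ is the left shift; on $X\times Y$ it acts diagonally. $M(X,Y,\mu)$ is the set of shift-invariant Borel probability measures $\nu$ on $X\times Y$ with $\nu(X\times A)=\mu(A)$ for all measurable $A\subseteq Y$; $M_{\mathcal{E}}(X,Y,\mu)$ is the subset of those ergodic for the shift on $X\times Y$. $\mathscr{B}_n(X)$ is the set of length-$n$ words appearing as consecutive subwords of elements of $X$; $d$ is Hamming distance, $B_r$ the Hamming ball. For $A,C\subseteq\Sigma^n$, a probability measure $\eta$ on $\Sigma^n$ and $\varepsilon>0$: $R_\varepsilon(C,A,\eta)=\min\{r\in\mathbb{Z}_{\ge0}:\eta(A\cap\bigcup_{\overline{x}\in C}B_r(\overline{x}))\ge1-\varepsilon\}$. With $\mu_n$ the marginal of $\mu$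 on coordinates $0,\dots,n-1$: $R_\varepsilon(X,Y,\mu)=\liminf_n\frac1nR_\varepsilon(\mathscr{B}_n(X),\mathscr{B}_n(Y),\mu_n)$, and the essential covering radius is $R_0(X,Y,\mu)=\lim_{\varepsilon\to0}R_\varepsilon(X,Y,\mu)$. *)

theory Defs
  imports "HOL-Probability.Probability"
begin

text \<open>The full shift over a finite alphabet: bi-infinite sequences int => 'a, with the
  product sigma-algebra of discrete factors (= Borel sigma-algebra of the product topology).\<close>
definition seq_space :: "(int \<Rightarrow> 'a) measure" where
  "seq_space = PiM UNIV (\<lambda>_. count_space UNIV)"

definition shift :: "(int \<Rightarrow> 'a) \<Rightarrow> (int \<Rightarrow> 'a)" where
  "shift x = (\<lambda>i. x (i + 1))"

text \<open>Constrained system: label sequences of bi-infinite paths in a finite edge-labelled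
  directed graph (vertices are naturals, edges are triples (source, label, target)).\<close>
definition constrained_system :: "(int \<Rightarrow> 'a) set \<Rightarrow> bool" where
  "constrained_system X \<longleftrightarrow>
     (\<exists>E :: (nat \<times> 'a \<times> nat) set. finite E \<and>
        X = {x. \<exists>p :: int \<Rightarrow> nat. \<forall>i. (p i, x i, p (i + 1)) \<in> E})"

definition invariant_measure :: "'b measure \<Rightarrow> ('b \<Rightarrow> 'b) \<Rightarrow> bool" where
  "invariant_measure M f \<longleftrightarrow> f \<in> measurable M M \<and>
     (\<forall>A\<in>sets M. emeasure M (f -` A \<inter> space M) = emeasure M A)"

definition ergodic_measure :: "'b measure \<Rightarrow> ('b \<Rightarrow> 'b) \<Rightarrow> bool" where
  "ergodic_measure M f \<longleftrightarrow> invariant_measure M f \<and>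
     (\<forall>A\<in>sets M. f -` A \<inter> space M = A \<longrightarrow> emeasure M A = 0 \<or> emeasure M A = 1)"

definition shift2 :: "(int \<Rightarrow> 'a) \<times> (int \<Rightarrow> 'a) \<Rightarrow> (int \<Rightarrow> 'a) \<times> (int \<Rightarrow> 'a)" where
  "shift2 = (\<lambda>(x, y). (shift x, shift y))"

definition couplings :: "(int \<Rightarrow> 'a) set \<Rightarrow> (int \<Rightarrow> 'a) set \<Rightarrow> (int \<Rightarrow> 'a) measure
     \<Rightarrow> ((int \<Rightarrow> 'a) \<times> (int \<Rightarrow> 'a)) measure set" where
  "couplings X Y \<mu> = {\<nu>. sets \<nu> = sets (seq_space \<Otimes>\<^sub>M seq_space) \<and> prob_space \<nu> \<and>
      emeasure \<nu> (X \<times> Y) = 1 \<and> invariant_measure \<nu> shift2 \<and>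
      (\<forall>A \<in> sets seq_space. A \<subseteq> Y \<longrightarrow> emeasure \<nu> (X \<times> A) = emeasure \<mu> A)}"

definition ergodic_couplings :: "(int \<Rightarrow> 'a) set \<Rightarrow> (int \<Rightarrow> 'a) set \<Rightarrow> (int \<Rightarrow> 'a) measure
     \<Rightarrow> ((int \<Rightarrow> 'a) \<times> (int \<Rightarrow> 'a)) measure set" where
  "ergodic_couplings X Y \<mu> = {\<nu> \<in> couplings X Y \<mu>. ergodic_measure \<nu> shift2}"

definition lang :: "(int \<Rightarrow> 'a) set \<Rightarrow> nat \<Rightarrow> 'a list set" where
  "lang X n = {w. length w = n \<and> (\<exists>x\<in>X. \<exists>i::int. \<forall>j<n. w ! j = x (i + int j))}"

definition hamming :: "'a list \<Rightarrow> 'a list \<Rightarrow> nat" where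
  "hamming u v = card {j. j < length u \<and> u ! j \<noteq> v ! j}"

definition hball :: "nat \<Rightarrow> nat \<Rightarrow> 'a list \<Rightarrow> 'a list set" where
  "hball n r u = {v. length v = n \<and> hamming u v \<le> r}"

definition marg :: "(int \<Rightarrow> 'a) measure \<Rightarrow> nat \<Rightarrow> 'a list set \<Rightarrow> real" where
  "marg \<mu> n S = measure \<mu> {y \<in> space \<mu>. map (\<lambda>j. y (int j)) [0..<n] \<in> S}"

text \<open>R_eps(C,A,eta) (min over nonneg integers; Inf {} = \<infinity> if no such r).\<close>
definition R_words :: "nat \<Rightarrow> real \<Rightarrow> 'a list set \<Rightarrow> 'a list set \<Rightarrow> ('a list set \<Rightarrow> real) \<Rightarrow> ereal" where
  "R_words n \<epsilon> C A \<eta> =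
     Inf {ereal (real r) | r :: nat. \<eta> (A \<inter> (\<Union>x\<in>C. hball n r x)) \<ge> 1 - \<epsilon>}"

definition R_eps :: "(int \<Rightarrow> 'a) set \<Rightarrow> (int \<Rightarrow> 'a) set \<Rightarrow> (int \<Rightarrow> 'a) measure \<Rightarrow> real \<Rightarrow> ereal" where
  "R_eps X Y \<mu> \<epsilon> = liminf (\<lambda>n. R_words n \<epsilon> (lang X n) (lang Y n) (marg \<mu> n) / ereal (real n))"

definition ess_cov_radius :: "(int \<Rightarrow> 'a) set \<Rightarrow> (int \<Rightarrow> 'a) set \<Rightarrow> (int \<Rightarrow> 'a) measure \<Rightarrow> ereal" where
  "ess_cov_radius X Y \<mu> = Lim (at_right 0) (\<lambda>\<epsilon>. R_eps X Y \<mu> \<epsilon>)"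

end

theory Submission
  imports Defs
begin

text \<open>Close words of \<open>X\<close> for most words of \<open>Y\<close> of length \<open>n\<close> give an almost invariant coupling of mismatch
  probability about \<open>R\<^sub>\<epsilon> / n\<close>; a limit along cylinder sets is an invariant coupling, so the infimum over
  all couplings is at most \<open>R\<^sub>0\<close>. Conversely, the ergodic theorem for an ergodic coupling \<open>\<nu>\<close> (only the
  upper bound in probability is needed) says that most words of \<open>Y\<close> have a word of \<open>X\<close> within relative
  distance \<open>\<nu> {x\<^sub>0 \<noteq> y\<^sub>0} + \<delta>\<close>, so \<open>R\<^sub>0\<close> is at most the infimum over ergodic couplings. The two infima
  agree because a linear functional on the compact convex set of couplings attains its minimum at an
  extreme point, and extreme couplings are ergodic: conditioning on an invariant set keeps the second
  marginal, as \<open>\<mu>\<close> is ergodic.\<close>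

section \<open>Compactness of measures on cylinder algebras\<close>

text \<open>All limits are tested on cylinders, sets depending on finitely many coordinates. They
  form a countable algebra, so one subsequence settles all of them, and by compactness every
  finitely additive probability on them is automatically continuous at the empty set. The
  approximating objects may therefore be mere finitely additive averages, and no topology on a space
  of measures enters. Support on \<open>X\<close> and \<open>Y\<close> survives the limit because a
  constrained system is a decreasing intersection of cylinders. The delicate point on the ergodic
  side is that the pieces of a non-ergodic coupling must again be couplings of the same
  \<open>\<mu>\<close>. The marginal of a conditioned coupling is dominated by a multiple of
  \<open>\<mu>\<close>, and a one-sided frequency bound already forces an invariant measure
  dominated by an ergodic one to coincide with it. The same weak ergodic theorem thus serves twice,
  and extreme points take the place of an ergodic decomposition.\<close>

lemma pointwise_convergent_subsequence:
  fixes f :: "nat \<Rightarrow> 'i::countable \<Rightarrow> 'b::first_countable_topology"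
  assumes "\<And>i. compact (S i)" and "\<And>n i. f n i \<in> S i"
  obtains r l where "strict_mono r" "\<And>i. l i \<in> S i" "\<And>i. (\<lambda>n. f (r n) i) \<longlonglongrightarrow> l i"
proof -
  have "compactin (product_topology (\<lambda>_. euclidean) UNIV) (PiE UNIV S)"
    using assms(1) by (auto simp: compactin_PiE)
  then have "compact (PiE UNIV S)"
    by (simp add: euclidean_product_topology)
  \<comment> \<open>Countability of the index type enters here: it makes the product first
    countable, so Tychonoff compactness gives convergent subsequences.\<close>
  then have "seq_compact (PiE UNIV S)"
    by (rule compact_imp_seq_compact)
  moreover have "\<forall>n. f n \<in> PiE UNIV S"
    using assms(2) by auto
  ultimately obtain l r where lr: "l \<in> PiE UNIV S" "strict_mono r" "(f \<circ> r) \<longlonglongrightarrow> l"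
    using seq_compactE by metis
  have "(\<lambda>n. f (r n) i) \<longlonglongrightarrow> l i" for i
    using continuous_on_tendsto_compose[OF continuous_on_product_coordinates lr(3)] by simp
  then show thesis
    using that[of r l] lr by auto
qed

lemma finite_valued_convergent_subsequence:
  fixes f :: "nat \<Rightarrow> 'i::countable \<Rightarrow> nat"
  assumes "\<And>i. finite (S i)" and "\<And>n i. f n i \<in> S i"
  obtains r l where "strict_mono r" "\<And>i. l i \<in> S i" "\<And>i. \<forall>\<^sub>F n in sequentially. f (r n) i = l i"
proof -
  obtain r l where rl: "strict_mono r" "\<And>i. l i \<in> S i" "\<And>i. (\<lambda>n. f (r n) i) \<longlonglongrightarrow> l i"
    using pointwise_convergent_subsequence[of S f] assms by (metis finite_imp_compact)
  have "\<forall>\<^sub>F n in sequentially. f (r n) i = l i" for i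
    using rl(3)[of i] by (simp add: tendsto_discrete)
  with rl show thesis
    using that by blast
qed

text \<open>Abstracts what single sequences and pairs of sequences share.
  \<open>finite_range\<close> and \<open>realize\<close> together are compactness: a pointwise limit
  of coordinate values is again the coordinate family of a point.\<close>

locale finite_coordinates =
  fixes c :: "'i::countable \<Rightarrow> 'z \<Rightarrow> nat"
  assumes finite_range: "\<And>i. finite (range (c i))"
    and realize: "\<And>f. (\<And>i. f i \<in> range (c i)) \<Longrightarrow> \<exists>z. \<forall>i. c i z = f i"
begin

text \<open>Dependence on a finite index set, rather than finite unions of basic cylinders, makes
  closure under complement immediate.\<close>

definition cyl :: "'z set set" where
  "cyl = {C. \<exists>J. finite J \<and> (\<forall>z z'. (\<forall>i\<in>J. c i z = c i z') \<longrightarrow> (z \<in> C \<longleftrightarrow> z' \<in> C))}"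

lemma cylI:
  "finite J \<Longrightarrow> (\<And>z z'. (\<And>i. i \<in> J \<Longrightarrow> c i z = c i z') \<Longrightarrow> z \<in> C \<Longrightarrow> z' \<in> C) \<Longrightarrow> C \<in> cyl"
  unfolding cyl_def mem_Collect_eq by (intro exI[of _ J] conjI allI impI iffI) (assumption, blast, metis)

lemma UNIV_cyl: "UNIV \<in> cyl"
  by (auto simp: cyl_def)

lemma cyl_Int: "A \<in> cyl \<Longrightarrow> B \<in> cyl \<Longrightarrow> A \<inter> B \<in> cyl"
proof -
  assume "A \<in> cyl" "B \<in> cyl"
  then obtain J K where "finite J" "\<And>z z'. (\<forall>i\<in>J. c i z = c i z') \<Longrightarrow> (z \<in> A \<longleftrightarrow> z' \<in> A)"
      "finite K" "\<And>z z'. (\<forall>i\<in>K. c i z = c i z') \<Longrightarrow> (z \<in> B \<longleftrightarrow> z' \<in> B)"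
    by (auto simp: cyl_def)
  then show ?thesis
    by (intro cylI[of "J \<union> K"]) (simp, metis IntE IntI UnCI)
qed

lemma cyl_Compl: "A \<in> cyl \<Longrightarrow> - A \<in> cyl"
  by (auto simp: cyl_def)

sublocale algebra UNIV cyl
  unfolding algebra_iff_Int using UNIV_cyl cyl_Int cyl_Compl
  by (auto simp: Compl_eq_Diff_UNIV[symmetric] intro: cylI[of "{}"])

text \<open>There are countably many finite index sets \<open>J\<close>, and over each
  \<open>J\<close> a cylinder is determined by a subset of the finitely many patterns on
  \<open>J\<close>.\<close>

lemma countable_cyl: "countable cyl"
proof -
  let ?r = "\<lambda>J z. restrict (\<lambda>i. c i z) J"
  have "cyl \<subseteq> (\<Union>J\<in>{J. finite J}. (\<lambda>S. ?r J -` S) ` Pow (PiE J (\<lambda>i. range (c i))))"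
  proof
    fix C assume "C \<in> cyl"
    then obtain J where J: "finite J" "\<And>z z'. (\<forall>i\<in>J. c i z = c i z') \<Longrightarrow> (z \<in> C \<longleftrightarrow> z' \<in> C)"
      by (auto simp: cyl_def)
    have "C = ?r J -` (?r J ` C)"
    proof (intro set_eqI iffI)
      fix z assume "z \<in> ?r J -` (?r J ` C)"
      then obtain z' where "z' \<in> C" "?r J z = ?r J z'" by auto
      moreover from this have "\<forall>i\<in>J. c i z = c i z'" by (metis restrict_apply)
      ultimately show "z \<in> C" using J(2) by blast
    qed auto
    moreover have "?r J ` C \<in> Pow (PiE J (\<lambda>i. range (c i)))" by auto
    ultimately show "C \<in> (\<Union>J\<in>{J. finite J}. (\<lambda>S. ?r J -` S) ` Pow (PiE J (\<lambda>i. range (c i))))"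
      using J(1) by blast
  qed
  moreover have "countable (\<Union>J\<in>{J. finite J}. (\<lambda>S. ?r J -` S) ` Pow (PiE J (\<lambda>i. range (c i))))"
    using finite_range
    by (intro countable_UN countable_image countable_Collect_finite)
      (auto intro!: countable_finite finite_PiE)
  ultimately show ?thesis
    by (rule countable_subset)
qed

lemma cyl_measurable:
  assumes M: "space M = UNIV" "\<And>i k. {z. c i z = k} \<in> sets M" and C: "C \<in> cyl"
  shows "C \<in> sets M"
proof -
  obtain J where J: "finite J" "\<And>z z'. (\<forall>i\<in>J. c i z = c i z') \<Longrightarrow> (z \<in> C \<longleftrightarrow> z' \<in> C)"
    using C unfolding cyl_def mem_Collect_eq by blast
  let ?r = "\<lambda>z. restrict (\<lambda>i. c i z) J"
  have "?r ` C \<subseteq> PiE J (\<lambda>i. range (c i))" by auto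
  then have fin: "finite (?r ` C)"
    using finite_PiE[OF J(1)] finite_range by (metis finite_subset)
  have "C = (\<Union>g\<in>?r ` C. {z \<in> space M. \<forall>i\<in>J. c i z = g i})"
  proof (intro set_eqI iffI)
    fix z assume "z \<in> (\<Union>g\<in>?r ` C. {z \<in> space M. \<forall>i\<in>J. c i z = g i})"
    then obtain z' where "z' \<in> C" "\<forall>i\<in>J. c i z = c i z'" by auto
    then show "z \<in> C" using J(2) by blast
  qed (auto simp: M)
  also have "\<dots> \<in> sets M"
    using M fin J(1) by (intro sets.finite_UN sets.sets_Collect_finite_All) auto
  finally show ?thesis .
qed

text \<open>Otherwise points \<open>z n\<close> of \<open>A n\<close> have a coordinatewise limit
  \<open>w\<close>. Membership in \<open>A n\<close> looks at finitely many coordinates, and on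
  these a late \<open>z (r k)\<close>, which lies in \<open>A n\<close>, agrees with
  \<open>w\<close>; so \<open>w\<close> lies in every \<open>A n\<close>.\<close>

lemma decseq_cyl_Inter_empty:
  assumes A: "range A \<subseteq> cyl" "decseq A" "(\<Inter>n. A n) = {}"
  shows "\<exists>n. A n = {}"
proof (rule ccontr)
  assume "\<nexists>n. A n = {}"
  then have "\<forall>n. \<exists>z. z \<in> A n" by auto
  then obtain z where z: "\<And>n. z n \<in> A n" by metis
  obtain r l where rl: "strict_mono r" "\<And>i. l i \<in> range (c i)"
      "\<And>i. \<forall>\<^sub>F n in sequentially. c i (z (r n)) = l i"
    by (rule finite_valued_convergent_subsequence[of "\<lambda>i. range (c i)" "\<lambda>n i. c i (z n)"])
      (use finite_range in auto)
  obtain w where w: "\<And>i. c i w = l i"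
    using realize[of l] rl(2) by auto
  have "w \<in> A n" for n
  proof -
    obtain J where J: "finite J" "\<And>z z'. (\<forall>i\<in>J. c i z = c i z') \<Longrightarrow> (z \<in> A n \<longleftrightarrow> z' \<in> A n)"
      using subsetD[OF A(1) rangeI[of A n]] unfolding cyl_def mem_Collect_eq by blast
    have "\<forall>\<^sub>F k in sequentially. \<forall>i\<in>J. c i (z (r k)) = l i"
      using rl(3) J(1) by (simp add: eventually_ball_finite_distrib)
    then have "\<forall>\<^sub>F k in sequentially. k \<ge> n \<and> (\<forall>i\<in>J. c i (z (r k)) = l i)"
      using eventually_ge_at_top by (rule eventually_conj[rotated])
    then obtain k where k: "k \<ge> n" "\<forall>i\<in>J. c i (z (r k)) = l i"
      using eventually_happens by fastforce
    have "z (r k) \<in> A n"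
      using z decseqD[OF A(2), of n "r k"] order_trans[OF k(1) seq_suble[OF rl(1)]] by blast
    then show "w \<in> A n"
      using J(2)[of "z (r k)" w] k(2) w by auto
  qed
  with A(3) show False by auto
qed

section \<open>Finitely additive probabilities on cylinders and their limits\<close>

definition content :: "('z set \<Rightarrow> real) \<Rightarrow> bool" where
  "content p \<longleftrightarrow> (\<forall>A\<in>cyl. 0 \<le> p A) \<and> p UNIV = 1 \<and>
     (\<forall>A\<in>cyl. \<forall>B\<in>cyl. A \<inter> B = {} \<longrightarrow> p (A \<union> B) = p A + p B)"

lemma content_le_1:
  assumes "content p" "A \<in> cyl" shows "p A \<le> 1"
proof -
  have "p (A \<union> - A) = p A + p (- A)" "0 \<le> p (- A)"
    using assms cyl_Compl unfolding content_def by blast+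
  then show ?thesis using assms by (auto simp: content_def)
qed

text \<open>Caratheodory's continuity condition holds trivially: a decreasing sequence of cylinders
  with empty intersection is empty from some index on.\<close>

lemma content_extends_to_measure:
  assumes p: "content p"
  obtains \<nu> where "prob_space \<nu>" "sets \<nu> = sigma_sets UNIV cyl" "\<And>C. C \<in> cyl \<Longrightarrow> measure \<nu> C = p C"
proof -
  have p0: "p {} = 0"
  proof -
    have "p ({} \<union> {}) = p {} + p {}"
      using p empty_sets unfolding content_def by blast
    then show ?thesis by simp
  qed
  have "\<exists>\<mu>. (\<forall>C\<in>cyl. \<mu> C = ennreal (p C)) \<and> measure_space UNIV (sigma_sets UNIV cyl) \<mu>"
  proof (rule caratheodory_empty_continuous)
    show "positive cyl (\<lambda>C. ennreal (p C))"
      by (simp add: positive_def p0)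
    show "additive cyl (\<lambda>C. ennreal (p C))"
      using p by (auto simp: additive_def content_def ennreal_plus)
    fix A :: "nat \<Rightarrow> 'z set" assume A: "range A \<subseteq> cyl" "decseq A" "(\<Inter>i. A i) = {}"
    then obtain n where n: "A n = {}" using decseq_cyl_Inter_empty by blast
    then have "A m = {}" if "m \<ge> n" for m using decseqD[OF A(2) that] by auto
    then have "\<forall>\<^sub>F m in sequentially. ennreal (p (A m)) = 0"
      unfolding eventually_sequentially using p0 by (metis ennreal_0)
    then show "(\<lambda>i. ennreal (p (A i))) \<longlonglongrightarrow> 0"
      by (simp add: tendsto_eventually)
  qed auto
  then obtain m where m: "\<And>C. C \<in> cyl \<Longrightarrow> m C = ennreal (p C)"
      "measure_space UNIV (sigma_sets UNIV cyl) m" by blast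
  define \<nu> where "\<nu> = measure_of UNIV cyl m"
  have sets: "sets \<nu> = sigma_sets UNIV cyl" by (simp add: \<nu>_def)
  have em: "emeasure \<nu> C = m C" if "C \<in> sigma_sets UNIV cyl" for C
    unfolding \<nu>_def using m(2) that by (simp add: emeasure_measure_of_conv)
  have emC: "emeasure \<nu> C = ennreal (p C)" if "C \<in> cyl" for C
    using em m that by auto
  have "prob_space \<nu>"
    using emC[OF UNIV_cyl] p by (intro prob_spaceI) (simp add: \<nu>_def content_def)
  moreover have "measure \<nu> C = p C" if "C \<in> cyl" for C
    using emC[OF that] p that by (simp add: measure_def content_def)
  ultimately show thesis using that sets by blast
qed

text \<open>Each condition in \<open>content\<close> involves finitely many cylinders and so passes
  to pointwise limits; countable additivity is recovered only at the end, by extension.\<close>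

lemma convergent_subsequence_of_contents:
  fixes p :: "nat \<Rightarrow> 'z set \<Rightarrow> real"
  assumes p: "\<And>n. content (p n)"
  obtains r \<nu> where "strict_mono r" "prob_space \<nu>" "sets \<nu> = sigma_sets UNIV cyl"
    "\<And>C. C \<in> cyl \<Longrightarrow> (\<lambda>n. p (r n) C) \<longlonglongrightarrow> measure \<nu> C"
proof -
  let ?e = "from_nat_into cyl"
  have ne: "cyl \<noteq> {}" using UNIV_cyl by auto
  have e: "?e k \<in> cyl" for k using from_nat_into[OF ne] .
  obtain r l where rl: "strict_mono r" "\<And>k. (\<lambda>n. p (r n) (?e k)) \<longlonglongrightarrow> l k"
  proof (rule pointwise_convergent_subsequence[of "\<lambda>_. {0..1::real}" "\<lambda>n k. p n (?e k)"])
    show "p n (?e k) \<in> {0..1}" for n k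
      using p[of n] e[of k] content_le_1 by (auto simp: content_def)
  qed auto
  define q where "q C = lim (\<lambda>n. p (r n) C)" for C
  have q: "(\<lambda>n. p (r n) C) \<longlonglongrightarrow> q C" if "C \<in> cyl" for C
    unfolding q_def using rl(2)[of "to_nat_on cyl C"] that countable_cyl
    by (auto simp: convergent_LIMSEQ_iff[symmetric] intro: convergentI)
  have "content q"
    unfolding content_def
  proof (intro conjI ballI impI)
    fix A B assume A: "A \<in> cyl" and B: "B \<in> cyl" and AB: "A \<inter> B = {}"
    have "(\<lambda>n. p (r n) A + p (r n) B) \<longlonglongrightarrow> q A + q B"
      using q A B by (intro tendsto_add) auto
    moreover have "p (r n) (A \<union> B) = p (r n) A + p (r n) B" for n
      using p A B AB unfolding content_def by blast
    ultimately show "q (A \<union> B) = q A + q B"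
      using q[of "A \<union> B"] A B by (auto intro: LIMSEQ_unique)
  next
    fix A assume "A \<in> cyl"
    then show "0 \<le> q A"
      using p by (intro LIMSEQ_le_const[OF q]) (auto simp: content_def)
  next
    show "q UNIV = 1"
      using q[OF UNIV_cyl] p by (auto simp: content_def LIMSEQ_const_iff)
  qed
  then obtain \<nu> where "prob_space \<nu>" "sets \<nu> = sigma_sets UNIV cyl" "\<And>C. C \<in> cyl \<Longrightarrow> measure \<nu> C = q C"
    using content_extends_to_measure by blast
  with q rl(1) show thesis
    using that by metis
qed

lemma content_measure:
  assumes "prob_space \<nu>" "sets \<nu> = sigma_sets UNIV cyl"
  shows "content (measure \<nu>)"
proof -
  interpret prob_space \<nu> by fact
  have "space \<nu> = UNIV"
    using assms(2) UNIV_cyl sets.top[of \<nu>] sets.sets_into_space[of UNIV \<nu>] by auto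
  then show ?thesis
    using assms(2) prob_space finite_measure_Union by (auto simp: content_def)
qed

lemma measure_eqI_cyl:
  assumes "prob_space M" "sets M = sigma_sets UNIV cyl" "prob_space N" "sets N = sigma_sets UNIV cyl"
    and "\<And>C. C \<in> cyl \<Longrightarrow> measure M C = measure N C"
  shows "M = N"
proof (rule measure_eqI_generator_eq[where E=cyl and \<Omega>=UNIV and A="\<lambda>_. UNIV"])
  interpret M: prob_space M by fact
  interpret N: prob_space N by fact
  show "Int_stable cyl" by (simp add: Int_stable_def cyl_Int)
  show "emeasure M C = emeasure N C" if "C \<in> cyl" for C
    using assms(5)[OF that] by (simp add: M.emeasure_eq_measure N.emeasure_eq_measure)
  show "emeasure M UNIV \<noteq> \<infinity>" by simp
qed (use assms UNIV_cyl in auto)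

text \<open>Minimising the measures of the countably many cylinders one after another, starting with
  \<open>C\<^sub>0\<close>, leaves a single measure, which is therefore extreme.\<close>
lemma extreme_minimizer:
  assumes K: "K \<noteq> {}" "\<And>\<nu>. \<nu> \<in> K \<Longrightarrow> prob_space \<nu>" "\<And>\<nu>. \<nu> \<in> K \<Longrightarrow> sets \<nu> = sigma_sets UNIV cyl"
    and closed: "\<And>\<nu>s \<nu>. (\<And>n::nat. \<nu>s n \<in> K) \<Longrightarrow> prob_space \<nu> \<Longrightarrow> sets \<nu> = sigma_sets UNIV cyl \<Longrightarrow>
        (\<And>C. C \<in> cyl \<Longrightarrow> (\<lambda>n. measure (\<nu>s n) C) \<longlonglongrightarrow> measure \<nu> C) \<Longrightarrow> \<nu> \<in> K"
    and C0: "C\<^sub>0 \<in> cyl"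
  obtains \<nu> where "\<nu> \<in> K" "\<And>\<nu>'. \<nu>' \<in> K \<Longrightarrow> measure \<nu> C\<^sub>0 \<le> measure \<nu>' C\<^sub>0"
    "\<And>\<nu>\<^sub>1 \<nu>\<^sub>2 t. \<nu>\<^sub>1 \<in> K \<Longrightarrow> \<nu>\<^sub>2 \<in> K \<Longrightarrow> 0 < t \<Longrightarrow> t < 1 \<Longrightarrow>
       (\<And>C. C \<in> cyl \<Longrightarrow> measure \<nu> C = t * measure \<nu>\<^sub>1 C + (1 - t) * measure \<nu>\<^sub>2 C) \<Longrightarrow> \<nu>\<^sub>1 = \<nu>"
proof -
  define e where "e k = (case k of 0 \<Rightarrow> C\<^sub>0 | Suc j \<Rightarrow> from_nat_into cyl j)" for k
  have ne: "cyl \<noteq> {}" using C0 by auto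
  have e: "e k \<in> cyl" for k
    using C0 from_nat_into[OF ne] by (auto simp: e_def split: nat.split)
  have e_surj: "\<exists>k. C = e k" if "C \<in> cyl" for C
    using that countable_cyl by (intro exI[of _ "Suc (to_nat_on cyl C)"]) (simp add: e_def)
  define L where "L = rec_nat K (\<lambda>k S. {\<nu>\<in>S. \<forall>\<nu>'\<in>S. measure \<nu> (e k) \<le> measure \<nu>' (e k)})"
  have L0: "L 0 = K" and LS: "L (Suc k) = {\<nu>\<in>L k. \<forall>\<nu>'\<in>L k. measure \<nu> (e k) \<le> measure \<nu>' (e k)}" for k
    by (simp_all add: L_def)
  have dec: "decseq L"
    by (rule decseq_SucI) (auto simp: LS)
  have LK: "L k \<subseteq> K" for k
    using decseqD[OF dec, of 0 k] by (simp add: L0)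
  \<comment> \<open>Minimality is a family of weak inequalities between measures of one cylinder, so
    it survives convergence on cylinders.\<close>
  have Lclosed: "\<nu> \<in> L k" if "\<And>n. \<nu>s n \<in> L k" "prob_space \<nu>" "sets \<nu> = sigma_sets UNIV cyl"
      "\<And>C. C \<in> cyl \<Longrightarrow> (\<lambda>n. measure (\<nu>s n) C) \<longlonglongrightarrow> measure \<nu> C" for \<nu>s :: "nat \<Rightarrow> 'z measure" and \<nu> k
    using that
  proof (induction k)
    case 0
    then show ?case using closed[of \<nu>s \<nu>] by (simp add: L0)
  next
    case (Suc k)
    have "\<nu> \<in> L k" using Suc by (auto simp: LS)
    moreover have "measure \<nu> (e k) \<le> measure \<nu>' (e k)" if "\<nu>' \<in> L k" for \<nu>'
      using Suc.prems(1) that by (intro LIMSEQ_le_const2[OF Suc.prems(4)[OF e]]) (auto simp: LS)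
    ultimately show ?case by (auto simp: LS)
  qed
  have subseq: "\<exists>r \<nu>. strict_mono r \<and> prob_space \<nu> \<and> sets \<nu> = sigma_sets UNIV cyl \<and>
      (\<forall>C\<in>cyl. (\<lambda>n. measure (\<nu>s (r n)) C) \<longlonglongrightarrow> measure \<nu> C)" if "\<And>n. \<nu>s n \<in> K" for \<nu>s :: "nat \<Rightarrow> 'z measure"
    using convergent_subsequence_of_contents[of "\<lambda>n. measure (\<nu>s n)"] content_measure K(2,3) that
    by metis
  have Lne: "L k \<noteq> {}" for k
  proof (induction k)
    case 0
    then show ?case by (simp add: L0 K)
  next
    case (Suc k)
    let ?m = "Inf ((\<lambda>\<nu>. measure \<nu> (e k)) ` L k)"
    have "?m \<in> closure ((\<lambda>\<nu>. measure \<nu> (e k)) ` L k)"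
      by (intro closure_contains_Inf) (use Suc in \<open>auto intro!: bdd_belowI[of _ 0]\<close>)
    then obtain ms where ms: "\<And>n. ms n \<in> (\<lambda>\<nu>. measure \<nu> (e k)) ` L k" "ms \<longlonglongrightarrow> ?m"
      unfolding closure_sequential by blast
    then have "\<forall>n. \<exists>\<nu>. \<nu> \<in> L k \<and> ms n = measure \<nu> (e k)" by blast
    then obtain \<nu>s where \<nu>s: "\<And>n. \<nu>s n \<in> L k" "\<And>n. ms n = measure (\<nu>s n) (e k)" by metis
    obtain r \<nu> where r: "strict_mono r" "prob_space \<nu>" "sets \<nu> = sigma_sets UNIV cyl"
        "\<And>C. C \<in> cyl \<Longrightarrow> (\<lambda>n. measure (\<nu>s (r n)) C) \<longlonglongrightarrow> measure \<nu> C"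
      using subseq[of \<nu>s] \<nu>s(1) LK by blast
    have "\<nu> \<in> L k" using Lclosed[of "\<nu>s \<circ> r"] \<nu>s(1) r by auto
    moreover have "measure \<nu> (e k) = ?m"
      using LIMSEQ_unique[OF r(4)[OF e[of k]]] LIMSEQ_subseq_LIMSEQ[OF ms(2) r(1)] \<nu>s(2)
      by (auto simp: o_def)
    moreover have "?m \<le> measure \<nu>' (e k)" if "\<nu>' \<in> L k" for \<nu>'
      using that by (intro cInf_lower) (auto intro!: bdd_belowI[of _ 0])
    ultimately show ?case by (auto simp: LS)
  qed
  then have "\<forall>k. \<exists>\<nu>. \<nu> \<in> L k" by auto
  then obtain \<nu>s where \<nu>s: "\<And>n. \<nu>s n \<in> L n" by metis
  obtain r \<nu> where r: "strict_mono r" "prob_space \<nu>" "sets \<nu> = sigma_sets UNIV cyl"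
      "\<And>C. C \<in> cyl \<Longrightarrow> (\<lambda>n. measure (\<nu>s (r n)) C) \<longlonglongrightarrow> measure \<nu> C"
    using subseq[of \<nu>s] \<nu>s(1) LK by blast
  have \<nu>: "\<nu> \<in> L k" for k
  \<comment> \<open>Dropping the first \<open>k\<close> terms leaves only indices
    \<open>r (n + k) \<ge> k\<close>, whose measures lie in \<open>L k\<close> because the sets
    \<open>L k\<close> decrease.\<close>
  proof (rule Lclosed[of "\<lambda>n. \<nu>s (r (n + k))"])
    show "\<nu>s (r (n + k)) \<in> L k" for n
      using \<nu>s[of "r (n + k)"] decseqD[OF dec, of k "r (n + k)"] seq_suble[OF r(1), of "n + k"] by auto
    show "(\<lambda>n. measure (\<nu>s (r (n + k))) C) \<longlonglongrightarrow> measure \<nu> C" if "C \<in> cyl" for C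
      using r(4)[OF that] by (rule LIMSEQ_ignore_initial_segment)
  qed (use r in auto)
  show thesis
  proof
    show "\<nu> \<in> K" using \<nu>[of 0] by (simp add: L0)
    show "measure \<nu> C\<^sub>0 \<le> measure \<nu>' C\<^sub>0" if "\<nu>' \<in> K" for \<nu>'
      using \<nu>[of "Suc 0"] that by (simp add: LS L0 e_def)
    fix \<nu>\<^sub>1 \<nu>\<^sub>2 t assume *: "\<nu>\<^sub>1 \<in> K" "\<nu>\<^sub>2 \<in> K" "0 < t" "t < (1::real)"
      and split: "\<And>C. C \<in> cyl \<Longrightarrow> measure \<nu> C = t * measure \<nu>\<^sub>1 C + (1 - t) * measure \<nu>\<^sub>2 C"
    \<comment> \<open>A proper mixture of two numbers that are both at least the minimum equals the
      minimum only if both do. Hence the two measures stay in the next set of minimisers, and the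
      induction goes through all cylinders.\<close>
    have eq: "measure \<nu>\<^sub>1 (e k) = measure \<nu> (e k) \<and> measure \<nu>\<^sub>2 (e k) = measure \<nu> (e k)"
      if "\<nu>\<^sub>1 \<in> L k" "\<nu>\<^sub>2 \<in> L k" for k
    proof -
      have "measure \<nu> (e k) \<le> measure \<nu>\<^sub>1 (e k)" "measure \<nu> (e k) \<le> measure \<nu>\<^sub>2 (e k)"
        using that \<nu>[of "Suc k"] by (auto simp: LS)
      moreover have "t * (measure \<nu>\<^sub>1 (e k) - measure \<nu> (e k)) + (1 - t) * (measure \<nu>\<^sub>2 (e k) - measure \<nu> (e k)) = 0"
        using split[OF e[of k]] by (simp add: algebra_simps)
      ultimately show ?thesis
        using *(3,4) by (smt (verit, best) mult_nonneg_nonneg mult_pos_pos)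
    qed
    have L12: "\<nu>\<^sub>1 \<in> L k \<and> \<nu>\<^sub>2 \<in> L k" for k
    proof (induction k)
      case (Suc k)
      with eq[of k] \<nu>[of "Suc k"] show ?case by (auto simp: LS)
    qed (use * in \<open>simp add: L0\<close>)
    show "\<nu>\<^sub>1 = \<nu>"
    proof (rule measure_eqI_cyl)
      show "measure \<nu>\<^sub>1 C = measure \<nu> C" if "C \<in> cyl" for C
        using e_surj[OF that] eq L12 by auto
    qed (use K * r in auto)
  qed
qed

end

section \<open>Visit frequencies under an ergodic transformation\<close>

text \<open>The Birkhoff sum of the indicator of \<open>B\<close>; dividing by \<open>n\<close>
  gives the visit frequency.\<close>

definition visits :: "('b \<Rightarrow> 'b) \<Rightarrow> 'b set \<Rightarrow> nat \<Rightarrow> 'b \<Rightarrow> real" where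
  "visits T B n z = (\<Sum>i<n. indicator B ((T ^^ i) z))"

lemma visits_nonneg: "0 \<le> visits T B n z"
  by (simp add: visits_def sum_nonneg)

lemma visits_Suc: "visits T B (Suc n) z = indicator B z + visits T B n (T z)"
  unfolding visits_def by (subst sum.lessThan_Suc_shift) (simp add: funpow_swap1)

lemma invariant_measurable_funpow:
  "invariant_measure M T \<Longrightarrow> T ^^ n \<in> measurable M M"
  by (induction n) (auto simp: invariant_measure_def intro: measurable_comp)

lemma invariant_emeasure_funpow:
  assumes "invariant_measure M T" "A \<in> sets M"
  shows "emeasure M ((T ^^ n) -` A \<inter> space M) = emeasure M A"
proof (induction n)
  case 0
  then show ?case using sets.sets_into_space[OF assms(2)] by (simp add: Int_absorb2)
next
  case (Suc n)
  have T: "T \<in> measurable M M" using assms by (simp add: invariant_measure_def)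
  have "(T ^^ Suc n) -` A \<inter> space M = T -` ((T ^^ n) -` A \<inter> space M) \<inter> space M"
    using measurable_space[OF T] by (auto simp: funpow_swap1)
  then show ?case
    using Suc assms measurable_sets[OF invariant_measurable_funpow[OF assms(1)] assms(2), of n]
    by (simp only: invariant_measure_def)
qed

lemma visits_measurable:
  assumes "invariant_measure M T" "B \<in> sets M"
  shows "visits T B n \<in> borel_measurable M"
proof -
  have [measurable]: "T ^^ i \<in> measurable M M" for i
    using invariant_measurable_funpow[OF assms(1)] .
  have [measurable]: "B \<in> sets M" by fact
  have "(\<lambda>z. \<Sum>i<n. indicat_real B ((T ^^ i) z)) \<in> borel_measurable M"
    by measurable
  then show ?thesis by (simp add: visits_def[abs_def])
qed

lemma (in prob_space) integral_visits:
  assumes "invariant_measure M T" "B \<in> events"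
  shows "integrable M (visits T B n)" "integral\<^sup>L M (visits T B n) = n * prob B"
proof -
  have *: "integrable M (\<lambda>z. indicat_real B ((T ^^ i) z))"
    "integral\<^sup>L M (\<lambda>z. indicat_real B ((T ^^ i) z)) = prob B" for i
  proof -
    note m = measurable_sets[OF invariant_measurable_funpow[OF assms(1)] assms(2), of i]
    have "integrable M (\<lambda>z. indicat_real ((T ^^ i) -` B \<inter> space M) z)"
      using m by (simp add: integrable_indicator_iff emeasure_eq_measure)
    then show "integrable M (\<lambda>z. indicat_real B ((T ^^ i) z))"
      by (rule Bochner_Integration.integrable_cong[THEN iffD1, rotated -1]) (auto simp: indicator_def)
    have "integral\<^sup>L M (\<lambda>z. indicat_real B ((T ^^ i) z)) =
        integral\<^sup>L M (\<lambda>z. indicat_real ((T ^^ i) -` B \<inter> space M) z)"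
      by (intro Bochner_Integration.integral_cong) (auto simp: indicator_def)
    also have "\<dots> = prob B"
      using m invariant_emeasure_funpow[OF assms, of i] by (simp add: measure_def)
    finally show "integral\<^sup>L M (\<lambda>z. indicat_real B ((T ^^ i) z)) = prob B" .
  qed
  then show "integrable M (visits T B n)" "integral\<^sup>L M (visits T B n) = n * prob B"
    by (simp_all add: visits_def[abs_def])
qed

lemma (in prob_space) visits_Markov:
  fixes a :: real
  assumes "invariant_measure M T" "B \<in> events" "0 < a" "0 < n"
  shows "prob {z \<in> space M. visits T B n z \<ge> a * n} \<le> prob B / a"
proof -
  have "prob {z \<in> space M. visits T B n z \<ge> a * n} \<le> integral\<^sup>L M (visits T B n) / (a * n)"
    using assms(3,4) integral_visits(1)[OF assms(1,2)]
    by (intro integral_Markov_inequality_measure[where A="space M"]) (auto simp: visits_nonneg)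
  then show ?thesis
    using assms integral_visits[OF assms(1,2), of n] by simp
qed

text \<open>By ergodicity the lower frequency of visits is almost surely constant, and by Markov's
  inequality this constant is at most the measure of the set.\<close>
lemma (in prob_space) ergodic_visits_AE:
  fixes c :: real
  assumes erg: "ergodic_measure M T" and B: "B \<in> events" and c: "prob B < c"
  shows "AE z in M. \<exists>n\<ge>1. visits T B n z \<le> c * n"
proof -
  have inv: "invariant_measure M T" using erg by (simp add: ergodic_measure_def)
  have T: "T \<in> measurable M M" using inv by (simp add: invariant_measure_def)
  have [measurable]: "visits T B n \<in> borel_measurable M" for n
    using visits_measurable[OF inv B] .
  \<comment> \<open>\<open>b k\<close> increases to \<open>c\<close>, so \<open>D\<close> says that
    the lower frequency of visits is at least \<open>c\<close>. Passing from \<open>z\<close> to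
    \<open>T z\<close> alters count and time by at most one each, which the growing gap between
    \<open>b k * n\<close> and \<open>b (Suc k) * n\<close> absorbs. This makes \<open>D\<close>
    exactly invariant; a condition at a single level need not be.\<close>
  define b where "b k = c - 1 / real (Suc k)" for k
  define D where "D = {z \<in> space M. \<forall>k. \<exists>N. \<forall>n\<ge>N. b k * n < visits T B n z}"
  have D[measurable]: "D \<in> events" unfolding D_def by measurable
  have ind: "0 \<le> indicat_real B z" "indicat_real B z \<le> 1" for z
    by (auto simp: indicator_def)
  have b_lt: "\<exists>N. \<forall>n\<ge>N. b k * real n + s \<le> b (Suc k) * real n" for k s
  proof -
    have d: "0 < b (Suc k) - b k" by (simp add: b_def frac_less2)
    obtain N :: nat where N: "s / (b (Suc k) - b k) \<le> N" using real_arch_simple by blast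
    have "b k * real n + s \<le> b (Suc k) * real n" if "n \<ge> N" for n
    proof -
      have "s / (b (Suc k) - b k) \<le> n" using N that by linarith
      then have "s \<le> real n * (b (Suc k) - b k)" using d by (simp add: pos_divide_le_eq)
      then show ?thesis by (simp add: algebra_simps)
    qed
    then show ?thesis by blast
  qed
  have "T z \<in> D" if z: "z \<in> D" for z
  proof -
    have "\<exists>N. \<forall>n\<ge>N. b k * n < visits T B n (T z)" for k
    proof -
      obtain N where N: "\<And>n. n \<ge> N \<Longrightarrow> b (Suc k) * n < visits T B n z"
        using z unfolding D_def by blast
      obtain N' where N': "\<And>n. n \<ge> N' \<Longrightarrow> b k * real n + (1 - b (Suc k)) \<le> b (Suc k) * real n"
        using b_lt by blast
      have "b k * n < visits T B n (T z)" if "n \<ge> max N N'" for n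
      proof -
        have "b k * n + 1 < indicator B z + visits T B n (T z)"
          using N[of "Suc n"] N'[of n] that by (auto simp: visits_Suc algebra_simps)
        then show ?thesis using ind[of z] by linarith
      qed
      then show ?thesis by blast
    qed
    then show ?thesis using that measurable_space[OF T] by (auto simp: D_def)
  qed
  moreover have "z \<in> D" if z: "T z \<in> D" "z \<in> space M" for z
  proof -
    have "\<exists>N. \<forall>n\<ge>N. b k * n < visits T B n z" for k
    proof -
      obtain N where N: "\<And>n. n \<ge> N \<Longrightarrow> b (Suc k) * n < visits T B n (T z)"
        using z unfolding D_def by blast
      obtain N' where N': "\<And>n. n \<ge> N' \<Longrightarrow> b k * real n + b k \<le> b (Suc k) * real n"
        using b_lt by blast
      have "b k * Suc n < visits T B (Suc n) z" if "n \<ge> max N N'" for n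
      proof -
        have "b k * Suc n < visits T B n (T z)"
          using N[of n] N'[of n] that by (auto simp: algebra_simps)
        then show ?thesis using ind[of z] unfolding visits_Suc by linarith
      qed
      then have "\<forall>n\<ge>Suc (max N N'). b k * n < visits T B n z"
        by (metis Suc_le_D Suc_le_mono)
      then show ?thesis by blast
    qed
    then show ?thesis using that by (auto simp: D_def)
  qed
  ultimately have "T -` D \<inter> space M = D"
    using sets.sets_into_space[OF D] by blast
  then have "emeasure M D = 0 \<or> emeasure M D = 1"
    using erg D by (auto simp: ergodic_measure_def)
  moreover have "emeasure M D \<noteq> 1"
  proof
    assume "emeasure M D = 1"
    then have D1: "prob D = 1" by (simp add: measure_def)
    \<comment> \<open>A level \<open>b k\<close> still above \<open>prob B\<close> makes Markov's
      bound \<open>prob B / b k\<close> smaller than one, against \<open>prob D = 1\<close>.\<close>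
    obtain k where k: "inverse (real (Suc k)) < c - prob B"
      using c reals_Archimedean[of "c - prob B"] by auto
    then have bk: "prob B < b k" by (simp add: b_def field_simps)
    then have bk0: "0 < b k" using measure_nonneg[of M B] by linarith
    define E where "E N = {z \<in> space M. \<forall>n\<ge>N. b k * n < visits T B n z}" for N
    have [measurable]: "E N \<in> events" for N unfolding E_def by measurable
    \<comment> \<open>On \<open>E (Suc N)\<close> the inequality holds at time \<open>Suc N\<close>
      itself, which is positive as Markov's inequality requires.\<close>
    have "prob (E (Suc N)) \<le> prob B / b k" for N
    proof -
      have "prob (E (Suc N)) \<le> prob {z \<in> space M. visits T B (Suc N) z \<ge> b k * Suc N}"
        by (intro finite_measure_mono) (auto simp: E_def less_imp_le)
      also have "\<dots> \<le> prob B / b k"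
        by (rule visits_Markov[OF inv B bk0]) simp
      finally show ?thesis .
    qed
    moreover have "(\<lambda>N. prob (E (Suc N))) \<longlonglongrightarrow> prob (\<Union>N. E (Suc N))"
      by (intro finite_Lim_measure_incseq) (auto simp: incseq_def E_def)
    ultimately have "prob (\<Union>N. E (Suc N)) \<le> prob B / b k"
      by (intro LIMSEQ_le_const2) auto
    moreover have "prob D \<le> prob (\<Union>N. E (Suc N))"
    proof (intro finite_measure_mono subsetI)
      fix z assume "z \<in> D"
      then obtain N where "z \<in> space M" "\<forall>n\<ge>N. b k * n < visits T B n z" by (auto simp: D_def)
      then have "z \<in> E (Suc N)" by (auto simp: E_def)
      then show "z \<in> (\<Union>N. E (Suc N))" by blast
    qed auto
    ultimately have "1 \<le> prob B / b k" using D1 by linarith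
    then show False using bk bk0 by (simp add: field_simps)
  qed
  ultimately have "D \<in> null_sets M" by auto
  then have "AE z in M. z \<notin> D" by (rule AE_not_in)
  then show ?thesis
  proof (rule AE_mp, intro AE_I2 impI)
    fix z assume "z \<in> space M" "z \<notin> D"
    then obtain k where k: "\<forall>N. \<exists>n\<ge>N. visits T B n z \<le> b k * n"
      by (force simp: D_def not_less)
    then obtain n where n: "n \<ge> 1" "visits T B n z \<le> b k * n" by blast
    have "b k * n \<le> c * n" by (intro mult_right_mono) (auto simp: b_def)
    with n show "\<exists>n\<ge>1. visits T B n z \<le> c * n" using order_trans by blast
  qed
qed

section \<open>The upper half of the ergodic theorem, in probability\<close>

lemma sum_lessThan_add: "(\<Sum>i<m + n. f i) = (\<Sum>i<m. f i) + (\<Sum>i<n. f (m + i))"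
  for f :: "nat \<Rightarrow> real"
  by (induction n) (simp_all add: add.assoc)

text \<open>Cut \<open>[s, s + N)\<close> greedily into blocks of length at most \<open>L\<close> on which the average is at most
  \<open>c\<close>, stepping over single points where no such block starts.\<close>
lemma sum_le_by_good_blocks:
  fixes a :: "nat \<Rightarrow> real" and c :: real
  assumes a: "\<And>i. 0 \<le> a i" "\<And>i. a i \<le> 1" and c: "0 \<le> c"
  shows "(\<Sum>i<N. a (s + i)) \<le> c * N +
     (\<Sum>i<N. of_bool (\<not> (\<exists>n\<in>{1..L}. (\<Sum>j<n. a (s + i + j)) \<le> c * n))) + L"
proof -
  define bad :: "nat \<Rightarrow> real" where
    "bad s = of_bool (\<not> (\<exists>n\<in>{1..L}. (\<Sum>j<n. a (s + j)) \<le> c * n))" for s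
  have bad_nonneg: "0 \<le> (\<Sum>i<N. bad (s + i))" for s N
    by (intro sum_nonneg) (simp add: bad_def)
  have "(\<Sum>i<N. a (s + i)) \<le> c * N + (\<Sum>i<N. bad (s + i)) + L"
  proof (induction N arbitrary: s rule: less_induct)
    case (less N)
    show ?case
    \<comment> \<open>A stretch of length at most \<open>L\<close> is paid for by the final summand
      \<open>L\<close>; in a longer one, any good block of length at most \<open>L\<close>
      fits.\<close>
    proof (cases "N \<le> L")
      case True
      have "(\<Sum>i<N. a (s + i)) \<le> N"
        using sum_mono[of "{..<N}" "\<lambda>i. a (s + i)" "\<lambda>_. 1"] a by simp
      moreover have "0 \<le> c * N" "real N \<le> L" using True c by auto
      ultimately show ?thesis using bad_nonneg[of s N] by linarith
    next
      case False
      have step: ?thesis if n: "1 \<le> n" "n \<le> N" "(\<Sum>j<n. a (s + j)) \<le> c * n + (\<Sum>i<n. bad (s + i))" for n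
      proof -
        obtain m where m: "N = n + m" using n(2) le_Suc_ex by blast
        have "(\<Sum>i<m. a ((s + n) + i)) \<le> c * m + (\<Sum>i<m. bad ((s + n) + i)) + L"
          using less.IH[of m "s + n"] n m by simp
        moreover have "(\<Sum>i<N. a (s + i)) = (\<Sum>i<n. a (s + i)) + (\<Sum>i<m. a ((s + n) + i))"
          "(\<Sum>i<N. bad (s + i)) = (\<Sum>i<n. bad (s + i)) + (\<Sum>i<m. bad ((s + n) + i))"
          by (simp_all add: m sum_lessThan_add add.assoc)
        moreover have "c * N = c * n + c * m" by (simp add: m algebra_simps)
        ultimately show ?thesis using n(3) by linarith
      qed
      show ?thesis
      proof (cases "\<exists>n\<in>{1..L}. (\<Sum>j<n. a (s + j)) \<le> c * n")
        case True
        then obtain n where n: "1 \<le> n" "n \<le> L" "(\<Sum>j<n. a (s + j)) \<le> c * n" by auto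
        show ?thesis
          using n False bad_nonneg[of s n] by (intro step[of n]) linarith+
      next
        case bad: False
        \<comment> \<open>A bad start counts as a block of length one, paid in full by its own
          \<open>bad\<close> term.\<close>
        have "a s \<le> c + bad s" using a(2)[of s] c bad by (simp add: bad_def)
        then show ?thesis using False by (intro step[of 1]) simp_all
      qed
    qed
  qed
  then show ?thesis by (simp add: bad_def add.assoc)
qed

text \<open>Points that start no good block of length at most \<open>L\<close> become rare as
  \<open>L\<close> grows, since almost every point starts some good block. By Markov's inequality
  most orbits meet them seldom, and the cutting into blocks then bounds the total number of
  visits.\<close>

lemma (in prob_space) ergodic_visits_limit:
  fixes d :: real
  assumes erg: "ergodic_measure M T" and B: "B \<in> events" and d: "0 < d"
  shows "(\<lambda>N. prob {z \<in> space M. visits T B N z > (prob B + d) * N}) \<longlonglongrightarrow> 0"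
proof -
  have inv: "invariant_measure M T" using erg by (simp add: ergodic_measure_def)
  have T: "T ^^ i \<in> measurable M M" for i using invariant_measurable_funpow[OF inv] .
  have [measurable]: "visits T B n \<in> borel_measurable M" for n
    using visits_measurable[OF inv B] .
  \<comment> \<open>The excess \<open>d\<close> is spent in three equal parts: on the rate of the
    good blocks, on visits to \<open>bad L\<close>, and on the leftover \<open>L\<close>.\<close>
  define c where "c = prob B + d / 3"
  have c0: "0 \<le> c" using d by (simp add: c_def)
  define bad where "bad L = {z \<in> space M. \<not> (\<exists>n\<in>{1..L}. visits T B n z \<le> c * n)}" for L :: nat
  have bad[measurable]: "bad L \<in> events" for L unfolding bad_def by measurable
  have "AE z in M. \<exists>n\<ge>1. visits T B n z \<le> c * n"
    using ergodic_visits_AE[OF erg B] d by (simp add: c_def)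
  then have "AE z in M. z \<notin> (\<Inter>L. bad L)"
    by (rule AE_mp) (rule AE_I2, fastforce simp: bad_def)
  then have "prob (\<Inter>L. bad L) = 0"
    by (intro prob_eq_0[THEN iffD2]) auto
  moreover have "(\<lambda>L. prob (bad L)) \<longlonglongrightarrow> prob (\<Inter>L. bad L)"
    by (intro finite_Lim_measure_decseq) (auto simp: decseq_def bad_def)
  ultimately have bad0: "(\<lambda>L. prob (bad L)) \<longlonglongrightarrow> 0" by simp
  show ?thesis
  proof (rule LIMSEQ_I)
    fix \<epsilon> :: real assume \<epsilon>: "0 < \<epsilon>"
    obtain L where L: "prob (bad L) < \<epsilon> * (d / 3)"
      using LIMSEQ_D[OF bad0, of "\<epsilon> * (d / 3)"] \<epsilon> d by auto
    obtain N\<^sub>0 :: nat where N0: "L / (d / 3) < N\<^sub>0" using reals_Archimedean2 by blast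
    have "prob {z \<in> space M. visits T B N z > (prob B + d) * N} < \<epsilon>" if N: "N \<ge> max 1 N\<^sub>0" for N
    proof -
      have LN: "L \<le> d / 3 * N"
      proof -
        have "L / (d / 3) < N" using N0 N by linarith
        then show ?thesis using d by (simp add: field_simps)
      qed
      have "prob {z \<in> space M. visits T B N z > (prob B + d) * N} \<le>
          prob {z \<in> space M. visits T (bad L) N z \<ge> d / 3 * N}"
      proof (intro finite_measure_mono subsetI CollectI conjI)
        fix z assume "z \<in> {z \<in> space M. visits T B N z > (prob B + d) * N}"
        then have z: "z \<in> space M" "visits T B N z > (prob B + d) * N" by auto
        then show "z \<in> space M" by simp
        have Tz: "(T ^^ i) z \<in> space M" for i using measurable_space[OF T z(1)] .
        have *: "(\<Sum>j<n. indicator B ((T ^^ (i + j)) z)) = visits T B n ((T ^^ i) z)" for n i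
          unfolding visits_def by (simp add: funpow_add add.commute)
        have **: "of_bool (\<not> (\<exists>n\<in>{1..L}. visits T B n ((T ^^ i) z) \<le> c * n)) = indicat_real (bad L) ((T ^^ i) z)" for i
          using Tz[of i] by (simp add: bad_def indicator_def)
        have "visits T B N z \<le> c * N + visits T (bad L) N z + L"
          using sum_le_by_good_blocks[of "\<lambda>i. indicator B ((T ^^ i) z)" c 0 N L] c0
          unfolding add_0 * ** by (simp add: visits_def)
        then show "visits T (bad L) N z \<ge> d / 3 * N"
          using z(2) LN by (simp add: c_def algebra_simps)
      qed (use visits_measurable[OF inv bad] in measurable)
      also have "\<dots> \<le> prob (bad L) / (d / 3)"
        using d N by (intro visits_Markov[OF inv bad]) auto
      also have "\<dots> < \<epsilon>"
        using L d by (simp add: field_simps)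
      finally show ?thesis .
    qed
    then show "\<exists>no. \<forall>n\<ge>no. norm (prob {z \<in> space M. visits T B n z > (prob B + d) * n} - 0) < \<epsilon>"
      by (intro exI[of _ "max 1 N\<^sub>0"]) auto
  qed
qed

text \<open>By invariance \<open>measure N B\<close> is the \<open>N\<close>-mean of the visit
  frequency of \<open>B\<close>. That frequency exceeds \<open>measure M B + d\<close> only on a set
  that is asymptotically null for \<open>M\<close>, hence by domination for
  \<open>N\<close>.\<close>

lemma ergodic_dominating_invariant_eq:
  fixes K :: real
  assumes M: "prob_space M" "ergodic_measure M T" and N: "prob_space N" "invariant_measure N T"
    and sets: "sets N = sets M" and le: "\<And>A. A \<in> sets M \<Longrightarrow> measure N A \<le> K * measure M A"
  shows "N = M"
proof -
  interpret M: prob_space M by fact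
  interpret N: prob_space N by fact
  have sp: "space N = space M" using sets by (rule sets_eq_imp_space_eq)
  have le': "measure N B \<le> measure M B" if B: "B \<in> sets M" for B
  proof (rule field_le_epsilon)
    fix d :: real assume d: "0 < d"
    let ?E = "\<lambda>n. {z \<in> space M. visits T B n z > (measure M B + d) * n}"
    have inv: "invariant_measure M T" using M by (simp add: ergodic_measure_def)
    have [measurable]: "visits T B n \<in> borel_measurable M" for n
      using visits_measurable[OF inv B] .
    have E: "?E n \<in> sets M" for n by measurable
    have bound: "measure N B \<le> (measure M B + d) + K * measure M (?E (Suc n))" for n
    proof -
      let ?n = "Suc n"
      have "?n * measure N B = integral\<^sup>L N (visits T B ?n)"
        using N.integral_visits[OF N(2)] B sets by simp
      also have "\<dots> \<le> integral\<^sup>L N (\<lambda>z. (measure M B + d) * ?n + ?n * indicat_real (?E ?n) z)"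
      proof (rule integral_mono)
        show "integrable N (visits T B ?n)" using N.integral_visits[OF N(2)] B sets by simp
        show "integrable N (\<lambda>z. (measure M B + d) * ?n + ?n * indicat_real (?E ?n) z)"
          using E sets by (auto intro!: Bochner_Integration.integrable_add simp: N.emeasure_eq_measure)
        fix z assume "z \<in> space N"
        have "visits T B ?n z \<le> ?n"
          unfolding visits_def using sum_mono[of "{..<?n}" "\<lambda>i. indicat_real B ((T ^^ i) z)" "\<lambda>_. 1"]
          by (simp add: indicator_def)
        moreover have "0 \<le> (measure M B + d) * ?n" using d by simp
        ultimately show "visits T B ?n z \<le> (measure M B + d) * ?n + ?n * indicat_real (?E ?n) z"
          using \<open>z \<in> space N\<close> by (auto simp: indicator_def sp not_less)
      qed
      also have "\<dots> = ?n * ((measure M B + d) + measure N (?E ?n))"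
        using E[of ?n] sets by (subst Bochner_Integration.integral_add) (auto simp: N.emeasure_eq_measure N.prob_space algebra_simps)
      finally have "measure N B \<le> (measure M B + d) + measure N (?E ?n)"
        by (simp only: mult_le_cancel_left_pos[of "real ?n"] of_nat_0_less_iff zero_less_Suc)
      then show ?thesis using le[OF E[of ?n]] by linarith
    qed
    have "(\<lambda>n. (measure M B + d) + K * measure M (?E (Suc n))) \<longlonglongrightarrow> (measure M B + d) + K * 0"
      using M.ergodic_visits_limit[OF M(2) B d]
      by (intro tendsto_intros) (rule LIMSEQ_Suc)
    then show "measure N B \<le> measure M B + d"
      using bound by (intro LIMSEQ_le_const) auto
  qed
  show ?thesis
  proof (rule measure_eqI[OF sets])
    fix A assume A: "A \<in> sets N"
    \<comment> \<open>Both measures are probabilities, so the inequality for the complement is the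
      reverse inequality for \<open>A\<close>.\<close>
    have "measure N A = measure M A"
      using le'[of A] le'[of "space M - A"] A sets M.prob_compl[of A] N.prob_compl[of A] sp by auto
    then show "emeasure N A = emeasure M A"
      by (simp add: M.emeasure_eq_measure N.emeasure_eq_measure)
  qed
qed

section \<open>Sequence spaces and constrained systems\<close>

lemma space_seq_space [simp]: "space seq_space = UNIV"
  by (simp add: seq_space_def space_PiM)

lemma measurable_seq_space_iff:
  "f \<in> measurable N seq_space \<longleftrightarrow> (\<forall>i. (\<lambda>z. f z i) \<in> measurable N (count_space UNIV))"
proof
  assume "f \<in> measurable N seq_space"
  then show "\<forall>i. (\<lambda>z. f z i) \<in> measurable N (count_space UNIV)"
    unfolding seq_space_def by (auto intro: measurable_compose[OF _ measurable_component_singleton])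
next
  assume "\<forall>i. (\<lambda>z. f z i) \<in> measurable N (count_space UNIV)"
  then have "(\<lambda>z i. f z i) \<in> measurable N (PiM UNIV (\<lambda>_. count_space UNIV))"
    by (intro measurable_PiM_single') simp_all
  then show "f \<in> measurable N seq_space"
    by (simp add: seq_space_def)
qed

lemma measurable_coordinate: "(\<lambda>x. x i) \<in> measurable seq_space (count_space UNIV)"
  unfolding seq_space_def by (rule measurable_component_singleton) simp

lemma shift_measurable: "shift \<in> measurable seq_space seq_space"
  by (simp add: measurable_seq_space_iff shift_def measurable_coordinate)

section \<open>Sequences and pairs as instances of finite coordinates\<close>

interpretation seq: finite_coordinates "\<lambda>(i::int) (x::int \<Rightarrow> 'a::finite). to_nat (x i)"
proof
  fix f :: "int \<Rightarrow> nat" assume f: "\<And>i. f i \<in> range (\<lambda>x::int \<Rightarrow> 'a. to_nat (x i))"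
  have "to_nat (from_nat (f i) :: 'a) = f i" for i
  proof -
    obtain x :: "int \<Rightarrow> 'a" where "f i = to_nat (x i)" using f[of i] by blast
    then show ?thesis by simp
  qed
  then show "\<exists>x::int \<Rightarrow> 'a. \<forall>i. to_nat (x i) = f i"
    by (intro exI[of _ "\<lambda>i. from_nat (f i)"]) simp
next
  fix i :: int
  have "range (\<lambda>x::int \<Rightarrow> 'a. to_nat (x i)) \<subseteq> range (to_nat :: 'a \<Rightarrow> nat)" by auto
  then show "finite (range (\<lambda>x::int \<Rightarrow> 'a. to_nat (x i)))"
    by (rule finite_subset) simp
qed

text \<open>Flattening a pair into one family of coordinates makes the cylinder theory available for
  pairs, including cylinders that are not rectangles.\<close>

definition pair_coordinate :: "bool \<times> int \<Rightarrow> (int \<Rightarrow> 'a::finite) \<times> (int \<Rightarrow> 'a) \<Rightarrow> nat" where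
  "pair_coordinate i z = to_nat ((if fst i then fst z else snd z) (snd i))"

interpretation pair: finite_coordinates "pair_coordinate :: bool \<times> int \<Rightarrow> (int \<Rightarrow> 'a::finite) \<times> (int \<Rightarrow> 'a) \<Rightarrow> nat"
proof
  fix f :: "bool \<times> int \<Rightarrow> nat"
  assume f: "\<And>i. f i \<in> range (pair_coordinate i :: (int \<Rightarrow> 'a) \<times> (int \<Rightarrow> 'a) \<Rightarrow> nat)"
  have "to_nat (from_nat (f i) :: 'a) = f i" for i
  proof -
    obtain z :: "(int \<Rightarrow> 'a) \<times> (int \<Rightarrow> 'a)" where "f i = pair_coordinate i z"
      using f[of i] by blast
    then show ?thesis by (simp add: pair_coordinate_def)
  qed
  then show "\<exists>z :: (int \<Rightarrow> 'a) \<times> (int \<Rightarrow> 'a). \<forall>i. pair_coordinate i z = f i"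
    by (intro exI[of _ "(\<lambda>i. from_nat (f (True, i)), \<lambda>i. from_nat (f (False, i)))"]) (auto simp: pair_coordinate_def)
next
  fix i :: "bool \<times> int"
  have "range (pair_coordinate i :: (int \<Rightarrow> 'a) \<times> (int \<Rightarrow> 'a) \<Rightarrow> nat) \<subseteq> range (to_nat :: 'a \<Rightarrow> nat)"
    by (auto simp: pair_coordinate_def)
  then show "finite (range (pair_coordinate i :: (int \<Rightarrow> 'a) \<times> (int \<Rightarrow> 'a) \<Rightarrow> nat))"
    by (rule finite_subset) simp
qed

lemma seq_cylI:
  assumes "finite J" "\<And>x x'. (\<And>i. i \<in> J \<Longrightarrow> x i = x' i) \<Longrightarrow> x \<in> C \<Longrightarrow> x' \<in> C"
  shows "C \<in> seq.cyl"
  by (rule seq.cylI[OF assms(1)]) (use assms(2) in force)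

lemma pair_cylI:
  assumes "finite J" "\<And>x y x' y'. (\<And>i. i \<in> J \<Longrightarrow> x i = x' i \<and> y i = y' i) \<Longrightarrow> (x, y) \<in> C \<Longrightarrow> (x', y') \<in> C"
  shows "C \<in> pair.cyl"
proof (rule pair.cylI[of "UNIV \<times> J"])
  fix z z' :: "(int \<Rightarrow> 'a) \<times> (int \<Rightarrow> 'a)"
  assume *: "\<And>i. i \<in> UNIV \<times> J \<Longrightarrow> pair_coordinate i z = pair_coordinate i z'" and "z \<in> C"
  have "fst z i = fst z' i \<and> snd z i = snd z' i" if "i \<in> J" for i
    using *[of "(True, i)"] *[of "(False, i)"] that by (auto simp: pair_coordinate_def)
  then show "z' \<in> C"
    using assms(2)[of "fst z" "fst z'" "snd z" "snd z'"] \<open>z \<in> C\<close> by simp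
qed (use assms in auto)

lemma seq_cylD:
  assumes "C \<in> seq.cyl"
  shows "\<exists>J. finite J \<and> (\<forall>x x'. (\<forall>i\<in>J. x i = x' i) \<longrightarrow> (x \<in> C \<longleftrightarrow> x' \<in> C))"
  using assms by (simp add: seq.cyl_def)

lemma pair_cylD:
  assumes "C \<in> pair.cyl"
  shows "\<exists>J. finite J \<and> (\<forall>x y x' y'. (\<forall>i\<in>J. x i = x' i \<and> y i = y' i) \<longrightarrow> ((x, y) \<in> C \<longleftrightarrow> (x', y') \<in> C))"
proof -
  obtain J where J: "finite J"
      "\<And>z z'. (\<forall>i\<in>J. pair_coordinate i z = pair_coordinate i z') \<Longrightarrow> (z \<in> C \<longleftrightarrow> z' \<in> C)"
    using assms unfolding pair.cyl_def mem_Collect_eq by blast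
  have "(x, y) \<in> C \<longleftrightarrow> (x', y') \<in> C" if "\<forall>i\<in>snd ` J. x i = x' i \<and> y i = y' i" for x y x' y'
    by (rule J(2)) (use that in \<open>auto simp: pair_coordinate_def\<close>)
  then show ?thesis
    using J(1) by (intro exI[of _ "snd ` J"]) auto
qed

lemma Times_cyl:
  assumes "U \<in> seq.cyl" "V \<in> seq.cyl"
  shows "U \<times> V \<in> pair.cyl"
proof -
  obtain J where J: "finite J" "\<And>x x'. (\<forall>i\<in>J. x i = x' i) \<Longrightarrow> x \<in> U \<longleftrightarrow> x' \<in> U"
    using seq_cylD[OF assms(1)] by blast
  obtain K where K: "finite K" "\<And>x x'. (\<forall>i\<in>K. x i = x' i) \<Longrightarrow> x \<in> V \<longleftrightarrow> x' \<in> V"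
    using seq_cylD[OF assms(2)] by blast
  show ?thesis
  proof (rule pair_cylI[of "J \<union> K"])
    fix x y x' y' :: "int \<Rightarrow> 'a"
    assume "\<And>i. i \<in> J \<union> K \<Longrightarrow> x i = x' i \<and> y i = y' i" "(x, y) \<in> U \<times> V"
    then show "(x', y') \<in> U \<times> V"
      using J(2)[of x x'] K(2)[of y y'] by auto
  qed (use J K in auto)
qed

lemma shift2_vimage_cyl:
  assumes "C \<in> pair.cyl" shows "shift2 -` C \<in> pair.cyl"
proof -
  obtain J where J: "finite J"
      "\<And>x y x' y'. (\<forall>i\<in>J. x i = x' i \<and> y i = y' i) \<Longrightarrow> (x, y) \<in> C \<longleftrightarrow> (x', y') \<in> C"
    using pair_cylD[OF assms] by blast
  show ?thesis
  proof (rule pair_cylI[of "(\<lambda>i. i + 1) ` J"])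
    fix x y x' y' :: "int \<Rightarrow> 'a"
    assume "\<And>i. i \<in> (\<lambda>i. i + 1) ` J \<Longrightarrow> x i = x' i \<and> y i = y' i" "(x, y) \<in> shift2 -` C"
    then show "(x', y') \<in> shift2 -` C"
      using J(2)[of "shift x" "shift x'" "shift y" "shift y'"] by (auto simp: shift2_def shift_def)
  qed (use J in auto)
qed

text \<open>Needed so that measures extended from cylinders live on the product sigma-algebra. One
  inclusion is measurability of the identity map, checked coordinatewise; the other holds because a
  cylinder is a finite union of patterns.\<close>

lemma sets_seq_space: "sets (seq_space :: (int \<Rightarrow> 'a::finite) measure) = sigma_sets UNIV seq.cyl"
proof
  let ?N = "sigma UNIV seq.cyl :: (int \<Rightarrow> 'a) measure"
  have "(\<lambda>x. x i) \<in> measurable ?N (count_space UNIV)" for i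
    by (subst measurable_count_space_eq2)
      (auto intro!: seq_cylI[of "{i}"] simp: sets_measure_of vimage_def)
  then have id: "(\<lambda>x. x) \<in> measurable ?N seq_space"
    by (simp add: measurable_seq_space_iff)
  show "sets (seq_space :: (int \<Rightarrow> 'a) measure) \<subseteq> sigma_sets UNIV seq.cyl"
    using measurable_sets[OF id] by (auto simp: sets_measure_of)
  have "{x. to_nat (x i) = k} \<in> sets (seq_space :: (int \<Rightarrow> 'a) measure)" for i :: int and k
  proof -
    have "{x. to_nat (x i) = k} = (\<lambda>x. x i) -` {a::'a. to_nat a = k} \<inter> space seq_space" by auto
    also have "\<dots> \<in> sets seq_space"
      by (rule measurable_sets[OF measurable_coordinate]) simp
    finally show ?thesis .
  qed
  then have "seq.cyl \<subseteq> sets (seq_space :: (int \<Rightarrow> 'a) measure)"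
    by (rule subsetI[OF seq.cyl_measurable[OF space_seq_space]])
  then show "sigma_sets UNIV seq.cyl \<subseteq> sets (seq_space :: (int \<Rightarrow> 'a) measure)"
    using sets.sigma_sets_subset[of seq.cyl seq_space] by simp
qed

lemma sets_pair_space:
  "sets (seq_space \<Otimes>\<^sub>M seq_space :: ((int \<Rightarrow> 'a::finite) \<times> (int \<Rightarrow> 'a)) measure) = sigma_sets UNIV pair.cyl"
proof
  let ?N = "sigma UNIV pair.cyl :: ((int \<Rightarrow> 'a) \<times> (int \<Rightarrow> 'a)) measure"
  let ?Z = "seq_space \<Otimes>\<^sub>M seq_space :: ((int \<Rightarrow> 'a) \<times> (int \<Rightarrow> 'a)) measure"
  have "(\<lambda>z. fst z i) \<in> measurable ?N (count_space UNIV)" "(\<lambda>z. snd z i) \<in> measurable ?N (count_space UNIV)" for i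
    by (subst measurable_count_space_eq2,
      auto intro!: pair_cylI[of "{i}"] simp: sets_measure_of vimage_def)+
  then have "fst \<in> measurable ?N seq_space" "snd \<in> measurable ?N seq_space"
    by (simp_all add: measurable_seq_space_iff)
  then have "(\<lambda>z. (fst z, snd z)) \<in> measurable ?N ?Z"
    by (rule measurable_Pair)
  then have id: "(\<lambda>z. z) \<in> measurable ?N ?Z" by simp
  show "sets ?Z \<subseteq> sigma_sets UNIV pair.cyl"
    using measurable_sets[OF id] by (auto simp: sets_measure_of)
  have "{z. pair_coordinate i z = k} \<in> sets ?Z" for i k
  proof -
    have "(\<lambda>z. (if fst i then fst z else snd z) (snd i)) \<in> measurable ?Z (count_space UNIV)"
      by (cases "fst i") (auto intro: measurable_compose[OF _ measurable_coordinate])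
    from measurable_sets[OF this, of "{a. to_nat a = k}"] show ?thesis
      by (simp add: vimage_def space_pair_measure pair_coordinate_def)
  qed
  then have "pair.cyl \<subseteq> sets ?Z"
    by (rule subsetI[OF pair.cyl_measurable[rotated]]) (simp_all add: space_pair_measure)
  then show "sigma_sets UNIV pair.cyl \<subseteq> sets ?Z"
    using sets.sigma_sets_subset[of pair.cyl ?Z] by (simp add: space_pair_measure)
qed

lemma seq_cyl_sets: "C \<in> seq.cyl \<Longrightarrow> C \<in> sets seq_space"
  by (auto simp: sets_seq_space)

lemma shift2_measurable:
  "shift2 \<in> measurable (seq_space \<Otimes>\<^sub>M seq_space) (seq_space \<Otimes>\<^sub>M seq_space)"
  unfolding shift2_def using shift_measurable by measurable

lemma shift_funpow: "(shift ^^ n) x = (\<lambda>i. x (i + int n))"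
  by (induction n) (auto simp: shift_def algebra_simps)

lemma shift2_funpow: "(shift2 ^^ n) (x, y) = ((shift ^^ n) x, (shift ^^ n) y)"
  by (induction n) (auto simp: shift2_def)

section \<open>Constrained systems as closed shift-invariant sets\<close>

lemma constrained_system_translate:
  assumes "constrained_system X" "x \<in> X"
  shows "(\<lambda>i. x (i + k)) \<in> X"
proof -
  obtain E :: "(nat \<times> 'a \<times> nat) set" where X: "X = {x. \<exists>p. \<forall>i. (p i, x i, p (i + 1)) \<in> E}"
    using assms(1) unfolding constrained_system_def by (elim exE conjE)
  then obtain p where p: "\<And>i. (p i, x i, p (i + 1)) \<in> E"
    using assms(2) by blast
  have "\<forall>i. (p (i + k), x (i + k), p (i + 1 + k)) \<in> E"
    using p[of "_ + k"] by (simp add: algebra_simps)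
  then show ?thesis
    unfolding X mem_Collect_eq by (intro exI[of _ "\<lambda>i. p (i + k)"])
qed

text \<open>\<open>U n\<close> asks for a path only along the window from \<open>-n\<close> to
  \<open>n\<close>, a condition on finitely many labels. For a point of all \<open>U n\<close>, the
  finite paths use finitely many vertices, and a coordinatewise limit of them is a bi-infinite
  path.\<close>

lemma constrained_system_Inter_cyl:
  fixes X :: "(int \<Rightarrow> 'a::finite) set"
  assumes "constrained_system X"
  obtains U where "decseq U" "\<And>n. U n \<in> seq.cyl" "X = (\<Inter>n::nat. U n)"
proof -
  obtain E :: "(nat \<times> 'a \<times> nat) set" where E: "finite E"
      and X: "X = {x. \<exists>p. \<forall>i. (p i, x i, p (i + 1)) \<in> E}"
    using assms unfolding constrained_system_def by (elim exE conjE)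
  define U where "U n = {x. \<exists>p. \<forall>i\<in>{- int n..int n}. (p i, x i, p (i + 1)) \<in> E}" for n
  define V where "V = insert 0 (fst ` E \<union> (snd \<circ> snd) ` E)"
  have V: "finite V" using E by (simp add: V_def)
  have dec: "decseq U"
    unfolding decseq_def U_def by fastforce
  have cyl: "U n \<in> seq.cyl" for n
  proof (rule seq_cylI[of "{- int n..int n}"])
    fix x x' :: "int \<Rightarrow> 'a" assume eq: "\<And>i. i \<in> {- int n..int n} \<Longrightarrow> x i = x' i" and "x \<in> U n"
    then obtain p where "\<forall>i\<in>{- int n..int n}. (p i, x i, p (i + 1)) \<in> E" by (auto simp: U_def)
    then show "x' \<in> U n" using eq unfolding U_def by auto
  qed simp
  have "x \<in> X" if x: "\<And>n. x \<in> U n" for x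
  proof -
    have "\<exists>p. (\<forall>i. p i \<in> V) \<and> (\<forall>i\<in>{- int n..int n}. (p i, x i, p (i + 1)) \<in> E)" for n
    proof -
      obtain p where p: "\<forall>i\<in>{- int n..int n}. (p i, x i, p (i + 1)) \<in> E" using x[of n] by (auto simp: U_def)
      \<comment> \<open>Outside the window \<open>p\<close> is arbitrary; the default
        \<open>0\<close>, put into \<open>V\<close> for this purpose, confines it to a finite set.
        Vertices met in the window are endpoints of edges and remain unchanged.\<close>
      let ?p = "\<lambda>i. if p i \<in> V then p i else 0"
      have "p i \<in> V \<and> p (i + 1) \<in> V" if "(p i, x i, p (i + 1)) \<in> E" for i
        using that by (force simp: V_def)
      then have "(?p i, x i, ?p (i + 1)) \<in> E" if "i \<in> {- int n..int n}" for i
        using p that by simp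
      moreover have "?p i \<in> V" for i by (simp add: V_def)
      ultimately show ?thesis by (intro exI[of _ ?p]) blast
    qed
    then obtain p where p: "\<And>n i. p n i \<in> V"
        "\<And>n i. i \<in> {- int n..int n} \<Longrightarrow> (p n i, x i, p n (i + 1)) \<in> E"
      by metis
    obtain r l where rl: "strict_mono r" "\<And>i. \<forall>\<^sub>F n in sequentially. p (r n) i = l i"
      by (rule finite_valued_convergent_subsequence[of "\<lambda>_. V" p]) (use V p in auto)
    have "(l i, x i, l (i + 1)) \<in> E" for i
    proof -
      have "\<forall>\<^sub>F n in sequentially. n \<ge> nat \<bar>i\<bar> \<and> p (r n) i = l i \<and> p (r n) (i + 1) = l (i + 1)"
        using rl(2) by (intro eventually_conj eventually_ge_at_top)
      then obtain n where n: "n \<ge> nat \<bar>i\<bar>" "p (r n) i = l i" "p (r n) (i + 1) = l (i + 1)"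
        using eventually_happens by fastforce
      have "r n \<ge> n" using seq_suble[OF rl(1)] .
      then have "i \<in> {- int (r n)..int (r n)}" using n(1) by auto
      from p(2)[OF this] show ?thesis using n by simp
    qed
    then show "x \<in> X" unfolding X by blast
  qed
  moreover have "X \<subseteq> U n" for n unfolding X U_def by blast
  ultimately have "X = (\<Inter>n. U n)" by blast
  with dec cyl show thesis using that by blast
qed

lemma constrained_system_measurable:
  fixes X :: "(int \<Rightarrow> 'a::finite) set"
  assumes "constrained_system X" shows "X \<in> sets seq_space"
proof -
  obtain U where "\<And>n. U n \<in> seq.cyl" "X = (\<Inter>n::nat. U n)"
    using constrained_system_Inter_cyl[OF assms] by blast
  then show ?thesis using seq_cyl_sets by auto
qed

section \<open>The convex set of couplings\<close>

abbreviation mismatch :: "((int \<Rightarrow> 'a) \<times> (int \<Rightarrow> 'a)) set" where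
  "mismatch \<equiv> {z. fst z 0 \<noteq> snd z 0}"

lemma mismatch_cyl: "mismatch \<in> pair.cyl"
  by (rule pair_cylI[of "{0}"]) auto

lemma pair_cyl_sets: "C \<in> pair.cyl \<Longrightarrow> C \<in> sets (seq_space \<Otimes>\<^sub>M seq_space)"
  by (auto simp: sets_pair_space)

lemma UNIV_sets_seq_space [simp]: "UNIV \<in> sets seq_space"
  using sets.top[of seq_space] by simp

locale coupling_setting =
  fixes X Y :: "(int \<Rightarrow> 'a::finite) set" and \<mu> :: "(int \<Rightarrow> 'a) measure"
  assumes X: "constrained_system X" and Y: "constrained_system Y"
    and sets_mu: "sets \<mu> = sets seq_space" and prob_mu: "prob_space \<mu>"
    and mu_Y: "emeasure \<mu> Y = 1" and ergodic_mu: "ergodic_measure \<mu> shift"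
begin

sublocale mu: prob_space \<mu> by (rule prob_mu)

abbreviation Z :: "((int \<Rightarrow> 'a) \<times> (int \<Rightarrow> 'a)) measure" where
  "Z \<equiv> seq_space \<Otimes>\<^sub>M seq_space"

lemma space_mu [simp]: "space \<mu> = UNIV"
  using sets_eq_imp_space_eq[OF sets_mu] by simp

lemma inv_mu: "invariant_measure \<mu> shift"
  using ergodic_mu by (simp add: ergodic_measure_def)

lemma space_Z: "sets \<nu> = sets Z \<Longrightarrow> space \<nu> = UNIV"
  by (drule sets_eq_imp_space_eq) (simp add: space_pair_measure)

lemma XY_sets [measurable]: "X \<in> sets seq_space" "Y \<in> sets seq_space"
  using X Y by (auto intro: constrained_system_measurable)

lemma measure_eq_on_support:
  assumes "prob_space \<nu>" "AE z in \<nu>. z \<in> S" "A \<in> sets \<nu>" "B \<in> sets \<nu>" "A \<inter> S = B \<inter> S"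
  shows "measure \<nu> A = measure \<nu> B"
proof -
  interpret prob_space \<nu> by fact
  show ?thesis
  proof (rule finite_measure_eq_AE)
    show "AE z in \<nu>. z \<in> A \<longleftrightarrow> z \<in> B"
      using assms(2) by eventually_elim (use assms(5) in blast)
  qed fact+
qed

lemma measure_Y_Int: "A \<in> sets seq_space \<Longrightarrow> measure \<mu> (A \<inter> Y) = measure \<mu> A"
proof -
  assume A: "A \<in> sets seq_space"
  have "measure \<mu> Y = 1" using mu_Y by (simp add: measure_def)
  then have "AE y in \<mu>. y \<in> Y"
    using XY_sets sets_mu by (intro mu.AE_prob_1) simp_all
  then show ?thesis
    using A XY_sets sets_mu by (intro mu.finite_measure_eq_AE) auto
qed

text \<open>Trades the marginal condition on \<open>X \<times> A\<close> for one on
  \<open>UNIV \<times> A\<close>, the form in which it is a statement about the image measure under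
  \<open>snd\<close>. The two agree because the mass sits on \<open>X \<times> Y\<close>.\<close>

lemma couplingsI:
  assumes sets: "sets \<nu> = sets Z" and prob: "prob_space \<nu>" and XY: "measure \<nu> (X \<times> Y) = 1"
    and inv: "invariant_measure \<nu> shift2"
    and marg: "\<And>A. A \<in> sets seq_space \<Longrightarrow> measure \<nu> (UNIV \<times> A) = measure \<mu> A"
  shows "\<nu> \<in> couplings X Y \<mu>"
proof -
  interpret prob_space \<nu> by fact
  have AE: "AE z in \<nu>. z \<in> X \<times> Y" using XY sets by (intro AE_prob_1) auto
  have "emeasure \<nu> (X \<times> A) = emeasure \<mu> A" if "A \<in> sets seq_space" for A
  proof -
    have "measure \<nu> (X \<times> A) = measure \<nu> (UNIV \<times> A)"
      using that sets XY_sets by (intro measure_eq_on_support[OF prob AE]) auto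
    then show ?thesis using marg[OF that] by (simp add: emeasure_eq_measure mu.emeasure_eq_measure)
  qed
  then show ?thesis
    unfolding couplings_def using sets prob XY inv by (simp add: emeasure_eq_measure)
qed

lemma couplingsD:
  assumes "\<nu> \<in> couplings X Y \<mu>"
  shows "sets \<nu> = sets Z" "prob_space \<nu>" "measure \<nu> (X \<times> Y) = 1" "invariant_measure \<nu> shift2"
    "AE z in \<nu>. z \<in> X \<times> Y" "\<And>A. A \<in> sets seq_space \<Longrightarrow> measure \<nu> (UNIV \<times> A) = measure \<mu> A"
proof -
  show sets: "sets \<nu> = sets Z" and prob: "prob_space \<nu>" and inv: "invariant_measure \<nu> shift2"
    using assms by (simp_all add: couplings_def)
  interpret prob_space \<nu> by (rule prob)
  show XY: "measure \<nu> (X \<times> Y) = 1"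
    using assms by (simp add: couplings_def measure_def)
  show AE: "AE z in \<nu>. z \<in> X \<times> Y" using XY sets by (intro AE_prob_1) auto
  fix A :: "(int \<Rightarrow> 'a) set" assume A: "A \<in> sets seq_space"
  have "measure \<nu> (UNIV \<times> A) = measure \<nu> (X \<times> (A \<inter> Y))"
    using A sets XY_sets by (intro measure_eq_on_support[OF prob AE]) auto
  also have "\<dots> = measure \<mu> (A \<inter> Y)"
  proof -
    have "A \<inter> Y \<in> sets seq_space" using A XY_sets by auto
    then have "emeasure \<nu> (X \<times> (A \<inter> Y)) = emeasure \<mu> (A \<inter> Y)"
      using assms unfolding couplings_def by blast
    then show ?thesis by (simp add: measure_def)
  qed
  finally show "measure \<nu> (UNIV \<times> A) = measure \<mu> A" using measure_Y_Int[OF A] by simp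
qed

text \<open>Replaces the event of the theorem by a cylinder, whose measure is controlled under
  limits.\<close>

lemma measure_mismatch:
  assumes "\<nu> \<in> couplings X Y \<mu>"
  shows "measure \<nu> {(x, y). (x, y) \<in> X \<times> Y \<and> x 0 \<noteq> y 0} = measure \<nu> mismatch"
proof -
  have m: "mismatch \<in> sets \<nu>"
    using couplingsD(1)[OF assms] by (simp add: pair_cyl_sets mismatch_cyl)
  have eq: "{(x, y). (x, y) \<in> X \<times> Y \<and> x 0 \<noteq> y 0} = X \<times> Y \<inter> mismatch" by auto
  show ?thesis
    unfolding eq using couplingsD(1)[OF assms] m XY_sets
    by (intro measure_eq_on_support[OF couplingsD(2,5)[OF assms]]) auto
qed

text \<open>Stated for set functions \<open>p n\<close> that are only asymptotically invariant, so
  that it serves both sequences of couplings and the finitely additive approximations built from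
  close words.\<close>

lemma limit_coupling:
  assumes prob: "prob_space \<nu>" and sets: "sets \<nu> = sets Z"
    and conv: "\<And>C. C \<in> pair.cyl \<Longrightarrow> (\<lambda>n. p n C) \<longlonglongrightarrow> measure \<nu> C"
    and supp: "\<And>n U V. U \<in> seq.cyl \<Longrightarrow> V \<in> seq.cyl \<Longrightarrow> X \<subseteq> U \<Longrightarrow> Y \<subseteq> V \<Longrightarrow> p n (U \<times> V) = 1"
    and marg: "\<And>n V. V \<in> seq.cyl \<Longrightarrow> p n (UNIV \<times> V) = measure \<mu> V"
    and inv: "\<And>C. C \<in> pair.cyl \<Longrightarrow> (\<lambda>n. p n (shift2 -` C) - p n C) \<longlonglongrightarrow> 0"
  shows "\<nu> \<in> couplings X Y \<mu>"
proof (rule couplingsI[OF sets prob])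
  interpret prob_space \<nu> by (rule prob)
  have sp: "space \<nu> = UNIV" using space_Z[OF sets] .
  obtain U where U: "decseq U" "\<And>n. U n \<in> seq.cyl" "X = (\<Inter>n::nat. U n)"
    using constrained_system_Inter_cyl[OF X] by blast
  obtain V where V: "decseq V" "\<And>n. V n \<in> seq.cyl" "Y = (\<Inter>n::nat. V n)"
    using constrained_system_Inter_cyl[OF Y] by blast
  have UV: "U n \<times> V n \<in> pair.cyl" for n using U V Times_cyl by blast
  have "measure \<nu> (U n \<times> V n) = 1" for n
  proof -
    have "p k (U n \<times> V n) = 1" for k using U V by (intro supp) auto
    then show ?thesis using conv[OF UV[of n]] by (simp add: LIMSEQ_const_iff)
  qed
  moreover have "(\<lambda>n. measure \<nu> (U n \<times> V n)) \<longlonglongrightarrow> measure \<nu> (\<Inter>n. U n \<times> V n)"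
  proof (rule finite_Lim_measure_decseq)
    show "range (\<lambda>n. U n \<times> V n) \<subseteq> events" using UV by (auto simp: sets sets_pair_space)
    show "decseq (\<lambda>n. U n \<times> V n)" using U(1) V(1) by (fastforce simp: decseq_def)
  qed
  moreover have "(\<Inter>n. U n \<times> V n) = X \<times> Y" using U(3) V(3) by auto
  ultimately show "measure \<nu> (X \<times> Y) = 1" by (simp add: LIMSEQ_const_iff)
  have T: "shift2 \<in> measurable \<nu> \<nu>"
    using shift2_measurable by (simp add: measurable_cong_sets[OF sets sets])
  \<comment> \<open>Written as an equality of measures, invariance can be checked on cylinders; the
    marginal condition is treated in the same way.\<close>
  have distr: "distr \<nu> \<nu> shift2 = \<nu>"
  proof (rule pair.measure_eqI_cyl)
    show "prob_space (distr \<nu> \<nu> shift2)" using T by (rule prob_space_distr)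
    fix C :: "((int \<Rightarrow> 'a) \<times> (int \<Rightarrow> 'a)) set" assume C: "C \<in> pair.cyl"
    have "(\<lambda>n. p n (shift2 -` C) - p n C) \<longlonglongrightarrow> measure \<nu> (shift2 -` C) - measure \<nu> C"
      using conv[OF C] conv[OF shift2_vimage_cyl[OF C]] by (rule tendsto_diff[rotated])
    then have "measure \<nu> (shift2 -` C) - measure \<nu> C = 0"
      using inv[OF C] by (rule LIMSEQ_unique)
    then show "measure (distr \<nu> \<nu> shift2) C = measure \<nu> C"
      using measure_distr[OF T, of C] pair_cyl_sets[OF C] by (simp add: sets sp)
  qed (simp_all add: prob sets sets_pair_space[symmetric])
  have "emeasure \<nu> (shift2 -` A \<inter> space \<nu>) = emeasure \<nu> A" if "A \<in> sets \<nu>" for A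
    using emeasure_distr[OF T that] by (simp add: distr)
  with T show "invariant_measure \<nu> shift2"
    unfolding invariant_measure_def by blast
  have snd: "snd \<in> measurable \<nu> seq_space"
    using measurable_snd by (simp add: measurable_cong_sets[OF sets refl])
  have eq: "distr \<nu> seq_space snd = \<mu>"
  proof (rule seq.measure_eqI_cyl)
    show "prob_space (distr \<nu> seq_space snd)" using snd by (rule prob_space_distr)
    fix V :: "(int \<Rightarrow> 'a) set" assume V: "V \<in> seq.cyl"
    have "UNIV \<times> V \<in> pair.cyl" using V Times_cyl seq.UNIV_cyl by blast
    then have "measure \<nu> (UNIV \<times> V) = measure \<mu> V"
      using conv[of "UNIV \<times> V"] marg[OF V] by (simp add: LIMSEQ_const_iff)
    moreover have "snd -` V \<inter> space \<nu> = UNIV \<times> V" by (auto simp: sp)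
    ultimately show "measure (distr \<nu> seq_space snd) V = measure \<mu> V"
      using snd seq_cyl_sets[OF V] by (simp add: measure_distr)
  qed (simp_all add: sets_mu prob_mu sets_seq_space[symmetric])
  fix A :: "(int \<Rightarrow> 'a) set" assume A: "A \<in> sets seq_space"
  have "snd -` A \<inter> space \<nu> = UNIV \<times> A" by (auto simp: sp)
  then show "measure \<nu> (UNIV \<times> A) = measure \<mu> A"
    using measure_distr[OF snd A] by (simp add: eq)
qed

section \<open>Ergodic couplings as extreme couplings\<close>

lemma couplings_closed:
  assumes "\<And>n. \<nu>s n \<in> couplings X Y \<mu>" "prob_space \<nu>" "sets \<nu> = sigma_sets UNIV pair.cyl"
    "\<And>C. C \<in> pair.cyl \<Longrightarrow> (\<lambda>n. measure (\<nu>s n) C) \<longlonglongrightarrow> measure \<nu> C"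
  shows "\<nu> \<in> couplings X Y \<mu>"
proof (rule limit_coupling[where p = "\<lambda>n. measure (\<nu>s n)"])
  fix n
  interpret n: prob_space "\<nu>s n" using couplingsD(2)[OF assms(1)] .
  note n = couplingsD[OF assms(1)[of n]]
  show "measure (\<nu>s n) (U \<times> V) = 1" if "U \<in> seq.cyl" "V \<in> seq.cyl" "X \<subseteq> U" "Y \<subseteq> V" for U V
  proof (rule antisym)
    have "X \<times> Y \<subseteq> U \<times> V" using that by auto
    then show "1 \<le> measure (\<nu>s n) (U \<times> V)"
      using n.finite_measure_mono[of "X \<times> Y" "U \<times> V"] n(1,3) that by (simp add: seq_cyl_sets)
  qed simp
  show "measure (\<nu>s n) (UNIV \<times> V) = measure \<mu> V" if "V \<in> seq.cyl" for V
    using n(6) seq_cyl_sets that by blast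
next
  fix C :: "((int \<Rightarrow> 'a) \<times> (int \<Rightarrow> 'a)) set" assume C: "C \<in> pair.cyl"
  have "measure (\<nu>s n) (shift2 -` C) = measure (\<nu>s n) C" for n
  proof -
    note n = couplingsD[OF assms(1)[of n]]
    have "emeasure (\<nu>s n) (shift2 -` C \<inter> space (\<nu>s n)) = emeasure (\<nu>s n) C"
      using n(1,4) pair_cyl_sets[OF C] unfolding invariant_measure_def by simp
    then show ?thesis using space_Z[OF n(1)] by (simp add: measure_def)
  qed
  then show "(\<lambda>n. measure (\<nu>s n) (shift2 -` C) - measure (\<nu>s n) C) \<longlonglongrightarrow> 0" by simp
qed (simp_all add: assms sets_pair_space)

lemma conditional_coupling:
  assumes \<nu>: "\<nu> \<in> couplings X Y \<mu>" and A: "A \<in> sets \<nu>" "shift2 -` A = A" and pos: "0 < measure \<nu> A"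
  shows "uniform_measure \<nu> A \<in> couplings X Y \<mu>"
proof -
  note n = couplingsD[OF \<nu>]
  interpret prob_space \<nu> by (rule n)
  have sp: "space \<nu> = UNIV" using space_Z[OF n(1)] .
  let ?\<nu> = "uniform_measure \<nu> A"
  have A0: "emeasure \<nu> A \<noteq> 0" "emeasure \<nu> A \<noteq> \<infinity>" using pos by (auto simp: emeasure_eq_measure)
  have meas: "measure ?\<nu> B = measure \<nu> (A \<inter> B) / measure \<nu> A" if "B \<in> sets \<nu>" for B
    using measure_uniform_measure[OF A0 that] .
  have prob': "prob_space ?\<nu>" using A0 by (intro prob_space_uniform_measure)
  interpret u: prob_space ?\<nu> by (rule prob')
  have sets': "sets ?\<nu> = sets Z" using n(1) by simp
  have T: "shift2 \<in> measurable \<nu> \<nu>" using n(4) by (simp add: invariant_measure_def)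
  have inv_meas: "measure \<nu> (shift2 -` B) = measure \<nu> B" if "B \<in> sets \<nu>" for B
    using n(4) that sp by (simp add: invariant_measure_def measure_def)
  have T_sets: "shift2 -` B \<in> sets \<nu>" if "B \<in> sets \<nu>" for B
    using measurable_sets[OF T that] sp by simp
  have inv_u: "measure ?\<nu> (shift2 -` B) = measure ?\<nu> B" if B: "B \<in> sets \<nu>" for B
  proof -
    have "A \<inter> shift2 -` B = shift2 -` (A \<inter> B)" using A(2) by auto
    then show ?thesis using meas[OF B] meas[OF T_sets[OF B]] inv_meas[of "A \<inter> B"] A(1) B by auto
  qed
  have inv': "invariant_measure ?\<nu> shift2"
    unfolding invariant_measure_def
  proof (intro conjI ballI)
    show "shift2 \<in> measurable ?\<nu> ?\<nu>" using T by (simp cong: measurable_cong_sets)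
    show "emeasure ?\<nu> (shift2 -` B \<inter> space ?\<nu>) = emeasure ?\<nu> B" if "B \<in> sets ?\<nu>" for B
      using inv_u[of B] that by (simp add: u.emeasure_eq_measure sp)
  qed
  show ?thesis
  proof (rule couplingsI[OF sets' prob' _ inv'])
    have "measure \<nu> (A \<inter> X \<times> Y) = measure \<nu> A"
      using n(1) A(1) by (intro measure_eq_on_support[OF n(2,5)]) auto
    then show "measure ?\<nu> (X \<times> Y) = 1"
      using meas[of "X \<times> Y"] n(1) pos by simp
    have snd: "snd \<in> measurable ?\<nu> seq_space"
      using measurable_snd by (simp add: measurable_cong_sets[OF sets' refl])
    have vim: "snd -` B \<inter> space \<nu> = UNIV \<times> B" for B :: "(int \<Rightarrow> 'a) set" by (auto simp: sp)
    \<comment> \<open>The projected measure is shift invariant and at most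
      \<open>1 / measure \<nu> A\<close> times \<open>\<mu>\<close>, since conditioning on
      \<open>A\<close> can enlarge a measure by no more than this factor.\<close>
    have "distr ?\<nu> seq_space snd = \<mu>"
    proof (rule ergodic_dominating_invariant_eq[OF prob_mu ergodic_mu, where K = "1 / measure \<nu> A"])
      let ?m = "distr ?\<nu> seq_space snd"
      show pm: "prob_space ?m" using snd by (rule u.prob_space_distr)
      interpret m: prob_space ?m by (rule pm)
      show "sets ?m = sets \<mu>" by (simp add: sets_mu)
      have shift_sets: "shift -` B \<in> sets seq_space" if "B \<in> sets seq_space" for B :: "(int \<Rightarrow> 'a) set"
        using measurable_sets[OF shift_measurable that] by simp
      show "invariant_measure ?m shift"
        unfolding invariant_measure_def
      proof (intro conjI ballI)
        show "shift \<in> measurable ?m ?m" using shift_measurable by simp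
        fix B :: "(int \<Rightarrow> 'a) set" assume B: "B \<in> sets ?m"
        have "UNIV \<times> shift -` B = shift2 -` (UNIV \<times> B)" by (auto simp: shift2_def)
        then have "measure ?\<nu> (UNIV \<times> shift -` B) = measure ?\<nu> (UNIV \<times> B)"
          using inv_u[of "UNIV \<times> B"] B n(1) by simp
        then show "emeasure ?m (shift -` B \<inter> space ?m) = emeasure ?m B"
          using B shift_sets[of B] measure_distr[OF snd, of B] measure_distr[OF snd, of "shift -` B"]
          by (simp add: m.emeasure_eq_measure vim)
      qed
      fix B :: "(int \<Rightarrow> 'a) set" assume "B \<in> sets \<mu>"
      then have B: "B \<in> sets seq_space" by (simp add: sets_mu)
      have "measure ?m B = measure \<nu> (A \<inter> UNIV \<times> B) / measure \<nu> A"
        using measure_distr[OF snd B] meas[of "UNIV \<times> B"] B n(1) by (simp add: vim)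
      also have "\<dots> \<le> measure \<nu> (UNIV \<times> B) / measure \<nu> A"
        using pos B n(1) by (intro divide_right_mono finite_measure_mono) auto
      finally show "measure ?m B \<le> 1 / measure \<nu> A * measure \<mu> B"
        using n(6)[OF B] by simp
    qed
    then show "measure ?\<nu> (UNIV \<times> B) = measure \<mu> B" if "B \<in> sets seq_space" for B
      using measure_distr[OF snd that] by (simp add: vim)
  qed
qed

lemma ergodic_coupling_le:
  assumes "\<nu>\<^sub>0 \<in> couplings X Y \<mu>"
  obtains \<nu> where "\<nu> \<in> ergodic_couplings X Y \<mu>" "measure \<nu> mismatch \<le> measure \<nu>\<^sub>0 mismatch"
proof (rule pair.extreme_minimizer[of "couplings X Y \<mu>" mismatch])
  show "couplings X Y \<mu> \<noteq> {}" using assms by auto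
  show "prob_space \<nu>" "sets \<nu> = sigma_sets UNIV pair.cyl" if "\<nu> \<in> couplings X Y \<mu>" for \<nu>
    using couplingsD[OF that] by (simp_all add: sets_pair_space)
next
  fix \<nu> assume \<nu>: "\<nu> \<in> couplings X Y \<mu>"
    and min: "\<And>\<nu>'. \<nu>' \<in> couplings X Y \<mu> \<Longrightarrow> measure \<nu> mismatch \<le> measure \<nu>' mismatch"
    and extreme: "\<And>\<nu>\<^sub>1 \<nu>\<^sub>2 t. \<nu>\<^sub>1 \<in> couplings X Y \<mu> \<Longrightarrow> \<nu>\<^sub>2 \<in> couplings X Y \<mu> \<Longrightarrow> 0 < t \<Longrightarrow> t < 1 \<Longrightarrow>
       (\<And>C. C \<in> pair.cyl \<Longrightarrow> measure \<nu> C = t * measure \<nu>\<^sub>1 C + (1 - t) * measure \<nu>\<^sub>2 C) \<Longrightarrow> \<nu>\<^sub>1 = \<nu>"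
  note n = couplingsD[OF \<nu>]
  interpret prob_space \<nu> by (rule n)
  have sp: "space \<nu> = UNIV" using space_Z[OF n(1)] .
  have "emeasure \<nu> A = 0 \<or> emeasure \<nu> A = 1" if A: "A \<in> sets \<nu>" "shift2 -` A = A" for A
  proof (rule ccontr)
    assume "\<not> (emeasure \<nu> A = 0 \<or> emeasure \<nu> A = 1)"
    then have t: "0 < measure \<nu> A" "measure \<nu> A < 1"
      using prob_le_1[of A] measure_nonneg[of \<nu> A] by (auto simp: emeasure_eq_measure less_le)
    have compl: "- A \<in> sets \<nu>" "measure \<nu> (- A) = 1 - measure \<nu> A"
      using sets.compl_sets[OF A(1)] prob_compl[OF A(1)] sp by (simp_all add: Compl_eq_Diff_UNIV)
    \<comment> \<open>\<open>\<nu>\<close> is the mixture of its conditionals on \<open>A\<close>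
      and \<open>- A\<close> with weights \<open>measure \<nu> A\<close> and its complement.
      Extremality would make the first conditional equal to \<open>\<nu>\<close>, yet it gives
      \<open>A\<close> full mass.\<close>
    have "uniform_measure \<nu> A = \<nu>"
    proof (rule extreme[of _ "uniform_measure \<nu> (- A)" "measure \<nu> A"])
      show "uniform_measure \<nu> A \<in> couplings X Y \<mu>"
        using conditional_coupling[OF \<nu> A t(1)] .
      show "uniform_measure \<nu> (- A) \<in> couplings X Y \<mu>"
        using compl t A by (intro conditional_coupling[OF \<nu>]) (simp_all add: vimage_Compl)
      fix C :: "((int \<Rightarrow> 'a) \<times> (int \<Rightarrow> 'a)) set" assume "C \<in> pair.cyl"
      then have C: "C \<in> sets \<nu>" using n(1) by (simp add: pair_cyl_sets)
      have "measure (uniform_measure \<nu> A) C = measure \<nu> (A \<inter> C) / measure \<nu> A"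
        using t C by (intro measure_uniform_measure) (auto simp: emeasure_eq_measure)
      moreover have "measure (uniform_measure \<nu> (- A)) C = measure \<nu> (- A \<inter> C) / (1 - measure \<nu> A)"
        using t C compl by (subst measure_uniform_measure) (auto simp: emeasure_eq_measure)
      moreover have "measure \<nu> C = measure \<nu> (A \<inter> C) + measure \<nu> (- A \<inter> C)"
      proof -
        have "measure \<nu> ((A \<inter> C) \<union> (- A \<inter> C)) = measure \<nu> (A \<inter> C) + measure \<nu> (- A \<inter> C)"
          using A(1) C compl by (intro finite_measure_Union) auto
        moreover have "(A \<inter> C) \<union> (- A \<inter> C) = C" by auto
        ultimately show ?thesis by simp
      qed
      ultimately show "measure \<nu> C = measure \<nu> A * measure (uniform_measure \<nu> A) C +
          (1 - measure \<nu> A) * measure (uniform_measure \<nu> (- A)) C"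
        using t by simp
    qed (use t in auto)
    moreover have "measure (uniform_measure \<nu> A) A = 1"
      using t A(1) by (subst measure_uniform_measure) (auto simp: emeasure_eq_measure)
    ultimately show False using t by simp
  qed
  then have "ergodic_measure \<nu> shift2"
    using n(4) by (simp add: ergodic_measure_def sp)
  then show thesis
    using that[of \<nu>] \<nu> min[OF assms] by (simp add: ergodic_couplings_def)
qed (use couplings_closed mismatch_cyl in blast)+

end

section \<open>Covering radii and couplings\<close>

abbreviation word :: "nat \<Rightarrow> (int \<Rightarrow> 'a) \<Rightarrow> 'a list" where
  "word n x \<equiv> map (\<lambda>j. x (int j)) [0..<n]"

lemma hamming_word: "real (hamming (word n x) (word n y)) = (\<Sum>i<n. of_bool (x (int i) \<noteq> y (int i)))"
proof -
  have "{j. j < length (word n x) \<and> word n x ! j \<noteq> word n y ! j} = {i \<in> {..<n}. x (int i) \<noteq> y (int i)}"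
    by auto
  then show ?thesis
    unfolding hamming_def by (simp add: of_bool_def sum.If_cases Int_def)
qed

text \<open>The bridge between combinatorics and dynamics: relative Hamming distance of two windows
  is an ergodic average.\<close>

lemma visits_mismatch: "visits shift2 mismatch n (x, y) = hamming (word n x) (word n y)"
  unfolding hamming_word visits_def by (simp add: shift2_funpow shift_funpow indicator_def of_bool_def)

lemma word_lang: "x \<in> X \<Longrightarrow> word n x \<in> lang X n"
  unfolding lang_def by (auto intro!: bexI[of _ x] exI[of _ 0])

text \<open>\<open>lang\<close> accepts an occurrence at any position; shift invariance of
  \<open>X\<close> moves it to the origin.\<close>

lemma lang_word:
  assumes "constrained_system X" "w \<in> lang X n"
  obtains x where "x \<in> X" "word n x = w"
proof -
  obtain x i where x: "x \<in> X" "length w = n" "\<forall>j<n. w ! j = x (i + int j)"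
    using assms(2) by (auto simp: lang_def)
  show thesis
  proof (rule that)
    show "(\<lambda>k. x (k + i)) \<in> X" using constrained_system_translate[OF assms(1) x(1)] .
    show "word n (\<lambda>k. x (k + i)) = w"
      using x by (intro nth_equalityI) (auto simp: add.commute)
  qed
qed

lemma word_cyl: "{y. P (word n y)} \<in> seq.cyl"
proof (rule seq_cylI[of "int ` {..<n}"])
  fix x x' :: "int \<Rightarrow> 'a" assume "\<And>i. i \<in> int ` {..<n} \<Longrightarrow> x i = x' i" "x \<in> {y. P (word n y)}"
  moreover from this have "word n x = word n x'" by auto
  ultimately show "x' \<in> {y. P (word n y)}" by simp
qed simp

section \<open>Passing between close words and couplings\<close>

context coupling_setting
begin

text \<open>Replace the window \<open>[0, n)\<close> of \<open>y\<close> by a close word of \<open>X\<close>, extended to a point of \<open>X\<close>, and average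
  the law of the resulting pair over the first \<open>n\<close> shifts: the second marginal stays \<open>\<mu>\<close>, and shift
  invariance fails by at most \<open>1 / n\<close>.\<close>
lemma approximating_content:
  assumes n: "0 < n" and \<epsilon>: "\<epsilon> < 1"
    and r: "marg \<mu> n (lang Y n \<inter> (\<Union>x\<in>lang X n. hball n r x)) \<ge> 1 - \<epsilon>"
  shows "\<exists>p. pair.content p \<and>
      (\<forall>U V. U \<in> seq.cyl \<longrightarrow> V \<in> seq.cyl \<longrightarrow> X \<subseteq> U \<longrightarrow> Y \<subseteq> V \<longrightarrow> p (U \<times> V) = 1) \<and>
      (\<forall>V. V \<in> seq.cyl \<longrightarrow> p (UNIV \<times> V) = measure \<mu> V) \<and>
      (\<forall>C. C \<in> pair.cyl \<longrightarrow> \<bar>p (shift2 -` C) - p C\<bar> \<le> 1 / n) \<and>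
      p mismatch \<le> r / n + \<epsilon>"
proof -
  define G where "G = lang Y n \<inter> (\<Union>x\<in>lang X n. hball n r x)"
  have G: "1 - \<epsilon> \<le> measure \<mu> {y. word n y \<in> G}"
    using r by (simp add: marg_def G_def)
  \<comment> \<open>From \<open>\<epsilon> < 1\<close> the good words have positive probability, so
    \<open>X\<close> has a point \<open>x\<^sub>0\<close>. It is the default choice of
    \<open>h\<close> on words outside \<open>G\<close>.\<close>
  have "G \<noteq> {}"
  proof
    assume "G = {}"
    then show False using G \<epsilon> by simp
  qed
  then obtain x\<^sub>0 where x0: "x\<^sub>0 \<in> X" unfolding G_def lang_def by blast
  have "\<exists>x\<in>X. w \<in> G \<longrightarrow> hamming (word n x) w \<le> r" for w
  proof (cases "w \<in> G")
    case True
    then obtain u where u: "u \<in> lang X n" "hamming u w \<le> r" by (auto simp: G_def hball_def)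
    obtain x where "x \<in> X" "word n x = u" using lang_word[OF X u(1)] by blast
    with u show ?thesis by blast
  qed (use x0 in auto)
  then obtain h where h: "\<And>w. h w \<in> X" "\<And>w. w \<in> G \<Longrightarrow> hamming (word n (h w)) w \<le> r"
    by metis
  define F where "F i y = (shift2 ^^ i) (h (word n y), y)" for i y
  have F_eq: "F i y = ((\<lambda>j. h (word n y) (j + int i)), (\<lambda>j. y (j + int i)))" for i y
    by (simp add: F_def shift2_funpow shift_funpow)
  \<comment> \<open>The point chosen by \<open>h\<close> depends on \<open>y\<close> only through
    \<open>n\<close> letters, so preimages of cylinders are cylinders and no measurable selection is
    involved.\<close>
  have F_vim: "F i -` C \<in> sets \<mu>" if C: "C \<in> pair.cyl" for i C
  proof -
    obtain J where J: "finite J"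
      "\<And>x y x' y'. (\<forall>i\<in>J. x i = x' i \<and> y i = y' i) \<Longrightarrow> (x, y) \<in> C \<longleftrightarrow> (x', y') \<in> C"
      using pair_cylD[OF C] by blast
    have "F i -` C \<in> seq.cyl"
    proof (rule seq_cylI[of "int ` {..<n} \<union> (\<lambda>j. j + int i) ` J"])
      fix y y' :: "int \<Rightarrow> 'a"
      assume eq: "\<And>j. j \<in> int ` {..<n} \<union> (\<lambda>j. j + int i) ` J \<Longrightarrow> y j = y' j" and "y \<in> F i -` C"
      have "word n y = word n y'" using eq by auto
      then have "h (word n y) = h (word n y')" by (rule arg_cong)
      moreover have "\<forall>j\<in>J. y (j + int i) = y' (j + int i)" using eq by auto
      ultimately have "F i y \<in> C \<longleftrightarrow> F i y' \<in> C"
        unfolding F_eq by (intro J(2)) (simp only: ball_simps simp_thms)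
      then show "y' \<in> F i -` C" using \<open>y \<in> F i -` C\<close> by simp
    qed (use J in auto)
    then show ?thesis using seq_cyl_sets sets_mu by blast
  qed
  define p where "p C = (\<Sum>i<n. measure \<mu> (F i -` C)) / n" for C
  show ?thesis
  proof (intro exI[of _ p] conjI allI impI)
    show "pair.content p"
      unfolding pair.content_def
    proof (intro conjI ballI impI)
      show "0 \<le> p C" for C by (simp add: p_def sum_nonneg)
      show "p UNIV = 1" using n mu.prob_space by (simp add: p_def)
      fix C D :: "((int \<Rightarrow> 'a) \<times> (int \<Rightarrow> 'a)) set"
      assume C: "C \<in> pair.cyl" and D: "D \<in> pair.cyl" and CD: "C \<inter> D = {}"
      have "measure \<mu> (F i -` (C \<union> D)) = measure \<mu> (F i -` C) + measure \<mu> (F i -` D)" for i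
        unfolding vimage_Un using CD by (intro mu.finite_measure_Union F_vim C D) auto
      then show "p (C \<union> D) = p C + p D"
        by (simp add: p_def sum.distrib add_divide_distrib)
    qed
  next
    fix U V :: "(int \<Rightarrow> 'a) set" assume UV: "U \<in> seq.cyl" "V \<in> seq.cyl" "X \<subseteq> U" "Y \<subseteq> V"
    have "measure \<mu> (F i -` (U \<times> V)) = 1" for i
    proof (rule antisym)
      have "Y \<subseteq> F i -` (U \<times> V)"
        using subsetD[OF UV(3) constrained_system_translate[OF X h(1)]]
          subsetD[OF UV(4) constrained_system_translate[OF Y]]
        by (auto simp: F_eq)
      then have "measure \<mu> Y \<le> measure \<mu> (F i -` (U \<times> V))"
        by (intro mu.finite_measure_mono F_vim Times_cyl UV)
      then show "1 \<le> measure \<mu> (F i -` (U \<times> V))"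
        using mu_Y by (simp add: measure_def)
    qed simp
    then show "p (U \<times> V) = 1" using n by (simp add: p_def)
  next
    fix V :: "(int \<Rightarrow> 'a) set" assume V: "V \<in> seq.cyl"
    have "measure \<mu> (F i -` (UNIV \<times> V)) = measure \<mu> V" for i
    proof -
      have "F i -` (UNIV \<times> V) = (shift ^^ i) -` V" by (auto simp: F_eq shift_funpow)
      then show ?thesis
        using invariant_emeasure_funpow[OF inv_mu, of V i] seq_cyl_sets[OF V] sets_mu
        by (simp add: measure_def)
    qed
    then show "p (UNIV \<times> V) = measure \<mu> V" using n by (simp add: p_def)
  next
    fix C :: "((int \<Rightarrow> 'a) \<times> (int \<Rightarrow> 'a)) set" assume C: "C \<in> pair.cyl"
    \<comment> \<open>Applying \<open>shift2\<close> turns the term \<open>i\<close> of the average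
      into the term \<open>Suc i\<close>; the difference telescopes to its two ends, hence the error
      \<open>1 / n\<close>.\<close>
    have vim: "F i -` (shift2 -` C) = F (Suc i) -` C" for i
      by (auto simp: F_def)
    have "(\<Sum>i<n. measure \<mu> (F (Suc i) -` C)) - (\<Sum>i<n. measure \<mu> (F i -` C)) =
        measure \<mu> (F n -` C) - measure \<mu> (F 0 -` C)"
      using sum_lessThan_telescope[of "\<lambda>i. measure \<mu> (F i -` C)" n] by (simp add: sum_subtractf)
    moreover have "\<bar>measure \<mu> (F n -` C) - measure \<mu> (F 0 -` C)\<bar> \<le> 1"
      using mu.prob_le_1[of "F n -` C"] mu.prob_le_1[of "F 0 -` C"]
        measure_nonneg[of \<mu> "F n -` C"] measure_nonneg[of \<mu> "F 0 -` C"] by linarith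
    ultimately show "\<bar>p (shift2 -` C) - p C\<bar> \<le> 1 / n"
      using n by (simp add: p_def vim diff_divide_distrib[symmetric] divide_right_mono)
  next
    have bad: "{y. word n y \<notin> G} \<in> sets \<mu>"
      unfolding sets_mu by (rule seq_cyl_sets[OF word_cyl])
    have good: "{y. word n y \<in> G} \<in> sets \<mu>"
      unfolding sets_mu by (rule seq_cyl_sets[OF word_cyl])
    have "{y. word n y \<notin> G} = space \<mu> - {y. word n y \<in> G}" by auto
    then have bad_le: "measure \<mu> {y. word n y \<notin> G} \<le> \<epsilon>"
      using G mu.prob_compl[OF good] by simp
    have ind: "integrable \<mu> (indicat_real A)" "integral\<^sup>L \<mu> (indicat_real A) = measure \<mu> A"
      if "A \<in> sets \<mu>" for A
      using that by (simp_all add: mu.emeasure_eq_measure)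
    note Fm = F_vim[OF mismatch_cyl]
    have "(\<Sum>i<n. measure \<mu> (F i -` mismatch)) = integral\<^sup>L \<mu> (\<lambda>y. \<Sum>i<n. indicat_real (F i -` mismatch) y)"
      using ind[OF Fm] by (subst Bochner_Integration.integral_sum) auto
    also have "\<dots> \<le> integral\<^sup>L \<mu> (\<lambda>y. real r + n * indicat_real {y. word n y \<notin> G} y)"
    proof (rule integral_mono)
      show "integrable \<mu> (\<lambda>y. \<Sum>i<n. indicat_real (F i -` mismatch) y)"
        using ind[OF Fm] by (intro Bochner_Integration.integrable_sum)
      show "integrable \<mu> (\<lambda>y. real r + n * indicat_real {y. word n y \<notin> G} y)"
        using ind[OF bad] by (intro Bochner_Integration.integrable_add integrable_mult_right) auto
      fix y
      \<comment> \<open>The \<open>n\<close> shifts place each position of the window at the origin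
        once, so the summed mismatches are the Hamming distance: at most \<open>r\<close> for words
        in \<open>G\<close> and at most \<open>n\<close> for the rest, which have probability at
        most \<open>\<epsilon>\<close>.\<close>
      have eq: "(\<Sum>i<n. indicat_real (F i -` mismatch) y) = hamming (word n (h (word n y))) (word n y)"
        unfolding hamming_word by (simp add: F_eq indicator_def of_bool_def)
      show "(\<Sum>i<n. indicat_real (F i -` mismatch) y) \<le> real r + n * indicat_real {y. word n y \<notin> G} y"
      proof (cases "word n y \<in> G")
        case True
        then show ?thesis unfolding eq using h(2)[OF True] by simp
      next
        case False
        have "(\<Sum>i<n. indicat_real (F i -` mismatch) y) \<le> n"
          using sum_mono[of "{..<n}" "\<lambda>i. indicat_real (F i -` mismatch) y" "\<lambda>_. 1"]
          by (simp add: indicator_def)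
        then show ?thesis using False by simp
      qed
    qed
    also have "\<dots> = r + n * measure \<mu> {y. word n y \<notin> G}"
      using ind[OF bad] mu.prob_space by (subst Bochner_Integration.integral_add) auto
    also have "\<dots> \<le> r + n * \<epsilon>"
      using bad_le by (simp add: mult_left_mono)
    finally have "p mismatch \<le> (r + n * \<epsilon>) / n"
      unfolding p_def by (rule divide_right_mono) simp
    also have "\<dots> = r / n + \<epsilon>"
      using n by (simp add: add_divide_distrib)
    finally show "p mismatch \<le> r / n + \<epsilon>" .
  qed
qed

text \<open>Letting the length grow while \<open>\<epsilon>\<close> shrinks makes both defects of
  the approximations, in invariance and in mismatch, vanish along one sequence.\<close>

lemma coupling_from_R_eps:
  assumes R: "\<And>\<epsilon>. 0 < \<epsilon> \<Longrightarrow> R_eps X Y \<mu> \<epsilon> < ereal c"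
  obtains \<nu> where "\<nu> \<in> couplings X Y \<mu>" "measure \<nu> mismatch \<le> c"
proof -
  \<comment> \<open>The double \<open>Suc\<close> keeps \<open>\<epsilon> 0\<close> strictly below
    one, as \<open>approximating_content\<close> requires.\<close>
  define \<epsilon> where "\<epsilon> k = inverse (real (Suc (Suc k)))" for k
  have \<epsilon>: "0 < \<epsilon> k" "\<epsilon> k < 1" for k by (simp_all add: \<epsilon>_def field_simps)
  have "\<exists>n r. k < n \<and> real r / n < c \<and> marg \<mu> n (lang Y n \<inter> (\<Union>x\<in>lang X n. hball n r x)) \<ge> 1 - \<epsilon> k" for k
  proof -
    \<comment> \<open>A lower limit below \<open>c\<close> is undercut at arbitrarily large lengths;
      asking for \<open>n > k\<close> drives the invariance error \<open>1 / n\<close> to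
      zero.\<close>
    have "\<exists>n>k. R_words n (\<epsilon> k) (lang X n) (lang Y n) (marg \<mu> n) / ereal (real n) < ereal c"
    proof (rule ccontr)
      assume "\<not> ?thesis"
      then have "\<forall>\<^sub>F n in sequentially. ereal c \<le> R_words n (\<epsilon> k) (lang X n) (lang Y n) (marg \<mu> n) / ereal (real n)"
        unfolding eventually_sequentially by (intro exI[of _ "Suc k"]) (metis Suc_le_eq not_less)
      then have "ereal c \<le> R_eps X Y \<mu> (\<epsilon> k)"
        unfolding R_eps_def by (rule Liminf_bounded)
      with R[OF \<epsilon>(1)[of k]] show False by simp
    qed
    then obtain n where n: "k < n"
        "R_words n (\<epsilon> k) (lang X n) (lang Y n) (marg \<mu> n) / ereal (real n) < ereal c" by blast
    then have "R_words n (\<epsilon> k) (lang X n) (lang Y n) (marg \<mu> n) < ereal (n * c)"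
      by (simp add: ereal_divide_less_pos)
    then obtain r where "real r < n * c" "marg \<mu> n (lang Y n \<inter> (\<Union>x\<in>lang X n. hball n r x)) \<ge> 1 - \<epsilon> k"
      unfolding R_words_def Inf_less_iff by auto
    with n(1) show ?thesis
      by (intro exI[of _ n] exI[of _ r]) (auto simp: field_simps)
  qed
  then obtain n r where nr: "\<And>k. k < n k" "\<And>k. real (r k) / n k < c"
      "\<And>k. marg \<mu> (n k) (lang Y (n k) \<inter> (\<Union>x\<in>lang X (n k). hball (n k) (r k) x)) \<ge> 1 - \<epsilon> k"
    by metis
  define Q where "Q k p \<longleftrightarrow> pair.content p \<and>
      (\<forall>U V. U \<in> seq.cyl \<longrightarrow> V \<in> seq.cyl \<longrightarrow> X \<subseteq> U \<longrightarrow> Y \<subseteq> V \<longrightarrow> p (U \<times> V) = 1) \<and>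
      (\<forall>V. V \<in> seq.cyl \<longrightarrow> p (UNIV \<times> V) = measure \<mu> V) \<and>
      (\<forall>C. C \<in> pair.cyl \<longrightarrow> \<bar>p (shift2 -` C) - p C\<bar> \<le> 1 / n k) \<and>
      p mismatch \<le> r k / n k + \<epsilon> k" for k p
  have "\<forall>k. \<exists>p. Q k p"
  proof
    fix k
    have "0 < n k" using nr(1)[of k] by simp
    then show "\<exists>p. Q k p"
      unfolding Q_def by (rule approximating_content[OF _ \<epsilon>(2) nr(3)])
  qed
  from choice[OF this] obtain p where "\<forall>k. Q k (p k)" ..
  then have p: "\<And>k. pair.content (p k)"
      "\<And>k U V. U \<in> seq.cyl \<Longrightarrow> V \<in> seq.cyl \<Longrightarrow> X \<subseteq> U \<Longrightarrow> Y \<subseteq> V \<Longrightarrow> p k (U \<times> V) = 1"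
      "\<And>k V. V \<in> seq.cyl \<Longrightarrow> p k (UNIV \<times> V) = measure \<mu> V"
      "\<And>k C. C \<in> pair.cyl \<Longrightarrow> \<bar>p k (shift2 -` C) - p k C\<bar> \<le> 1 / n k"
      "\<And>k. p k mismatch \<le> r k / n k + \<epsilon> k"
    unfolding Q_def by blast+
  obtain s \<nu> where s: "strict_mono s" and \<nu>: "prob_space \<nu>" "sets \<nu> = sigma_sets UNIV pair.cyl"
      and conv: "\<And>C. C \<in> pair.cyl \<Longrightarrow> (\<lambda>k. p (s k) C) \<longlonglongrightarrow> measure \<nu> C"
    using pair.convergent_subsequence_of_contents[of p, OF p(1)] by blast
  have inv: "(\<lambda>k. p k (shift2 -` C) - p k C) \<longlonglongrightarrow> 0" if C: "C \<in> pair.cyl" for C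
  proof (rule Lim_null_comparison)
    have "\<bar>p k (shift2 -` C) - p k C\<bar> \<le> inverse (real (Suc k))" for k
    proof -
      have "real (Suc k) \<le> n k" using nr(1)[of k] by linarith
      then have "1 / real (n k) \<le> inverse (real (Suc k))"
        by (simp add: inverse_eq_divide frac_le)
      with p(4)[OF C, of k] show ?thesis by linarith
    qed
    then show "\<forall>\<^sub>F k in sequentially. norm (p k (shift2 -` C) - p k C) \<le> inverse (real (Suc k))"
      by simp
    show "(\<lambda>k. inverse (real (Suc k))) \<longlonglongrightarrow> 0" by (rule LIMSEQ_inverse_real_of_nat)
  qed
  show thesis
  proof (rule that)
    show "\<nu> \<in> couplings X Y \<mu>"
    proof (rule limit_coupling[where p = "\<lambda>k. p (s k)"])
      show "(\<lambda>k. p (s k) (shift2 -` C) - p (s k) C) \<longlonglongrightarrow> 0" if "C \<in> pair.cyl" for C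
        using LIMSEQ_subseq_LIMSEQ[OF inv[OF that] s] by (simp add: o_def)
    qed (use \<nu> conv p in \<open>simp_all add: sets_pair_space\<close>)
    have "\<epsilon> \<longlonglongrightarrow> 0"
      unfolding \<epsilon>_def using LIMSEQ_Suc[OF LIMSEQ_inverse_real_of_nat] by simp
    then have "(\<lambda>k. c + \<epsilon> (s k)) \<longlonglongrightarrow> c + 0"
      using LIMSEQ_subseq_LIMSEQ[OF _ s] by (intro tendsto_add) (auto simp: o_def)
    moreover have "p (s k) mismatch \<le> c + \<epsilon> (s k)" for k
      using p(5)[of "s k"] nr(2)[of "s k"] by linarith
    ultimately show "measure \<nu> mismatch \<le> c"
      using LIMSEQ_le[OF conv[OF mismatch_cyl], of "\<lambda>k. c + \<epsilon> (s k)" c] by simp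
  qed
qed

text \<open>For a typical pair \<open>(x, y)\<close> the window of \<open>x\<close> is itself a word
  of \<open>X\<close> close to the window of \<open>y\<close>. So the exceptional words of
  \<open>Y\<close> have at most the probability of the exceptional pairs.\<close>

lemma R_eps_le_ergodic:
  assumes \<nu>: "\<nu> \<in> ergodic_couplings X Y \<mu>" and \<epsilon>: "0 < \<epsilon>"
  shows "R_eps X Y \<mu> \<epsilon> \<le> ereal (measure \<nu> mismatch)"
proof (rule ereal_le_epsilon2)
  fix d :: real assume d: "0 < d"
  have \<nu>c: "\<nu> \<in> couplings X Y \<mu>" and erg: "ergodic_measure \<nu> shift2"
    using \<nu> by (simp_all add: ergodic_couplings_def)
  note n = couplingsD[OF \<nu>c]
  interpret prob_space \<nu> by (rule n)
  have sp: "space \<nu> = UNIV" using space_Z[OF n(1)] .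
  define q where "q = measure \<nu> mismatch + d"
  have q: "0 < q" using d measure_nonneg[of \<nu> mismatch] unfolding q_def by linarith
  have mm: "mismatch \<in> sets \<nu>" using n(1) by (simp add: pair_cyl_sets mismatch_cyl)
  have [measurable]: "visits shift2 mismatch k \<in> borel_measurable \<nu>" for k
    using visits_measurable[OF n(4) mm] .
  have "(\<lambda>k. prob {z \<in> space \<nu>. visits shift2 mismatch k z > q * k}) \<longlonglongrightarrow> 0"
    unfolding q_def using ergodic_visits_limit[OF erg mm d] .
  then have "\<forall>\<^sub>F k in sequentially. prob {z \<in> space \<nu>. visits shift2 mismatch k z > q * k} < \<epsilon>"
    using \<epsilon> by (rule order_tendstoD)
  then have "\<forall>\<^sub>F k in sequentially. R_words k \<epsilon> (lang X k) (lang Y k) (marg \<mu> k) / ereal (real k) \<le> ereal q"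
    using eventually_gt_at_top[of 0]
  proof eventually_elim
    case (elim k)
    \<comment> \<open>Hamming distances are integers, so rounding \<open>q * k\<close> down to an
      admissible radius loses no pair.\<close>
    define r where "r = nat \<lfloor>q * k\<rfloor>"
    define S where "S = lang Y k \<inter> (\<Union>x\<in>lang X k. hball k r x)"
    let ?E = "{z \<in> space \<nu>. visits shift2 mismatch k z > q * k}"
    have S: "{y. word k y \<in> S} \<in> sets seq_space" by (rule seq_cyl_sets[OF word_cyl])
    have sub: "(X \<times> Y) - ?E \<subseteq> UNIV \<times> {y. word k y \<in> S}"
    proof
      fix z assume z: "z \<in> (X \<times> Y) - ?E"
      obtain x y where xy: "z = (x, y)" by (cases z)
      have "x \<in> X" "y \<in> Y" "real (hamming (word k x) (word k y)) \<le> q * k"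
        using z by (auto simp: xy sp visits_mismatch not_less)
      then have "hamming (word k x) (word k y) \<le> r"
        unfolding r_def by (simp add: le_nat_floor)
      then have "word k y \<in> S"
        unfolding S_def hball_def using word_lang \<open>x \<in> X\<close> \<open>y \<in> Y\<close> by fastforce
      then show "z \<in> UNIV \<times> {y. word k y \<in> S}" by (simp add: xy)
    qed
    have E: "?E \<in> sets \<nu>" by measurable
    have "1 - \<epsilon> \<le> prob (X \<times> Y) - prob ?E" using elim n(3) by simp
    also have "\<dots> \<le> prob ((X \<times> Y) - ?E)"
    proof -
      have "prob (X \<times> Y) \<le> prob (((X \<times> Y) - ?E) \<union> ?E)"
        using E n(1) by (intro finite_measure_mono) auto
      also have "\<dots> \<le> prob ((X \<times> Y) - ?E) + prob ?E"
        using E n(1) by (intro measure_Un_le) auto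
      finally show ?thesis by simp
    qed
    also have "\<dots> \<le> prob (UNIV \<times> {y. word k y \<in> S})"
      using S n(1) by (intro finite_measure_mono sub) auto
    also have "\<dots> = measure \<mu> {y. word k y \<in> S}" using n(6)[OF S] .
    finally have "marg \<mu> k (lang Y k \<inter> (\<Union>x\<in>lang X k. hball k r x)) \<ge> 1 - \<epsilon>"
      by (simp add: marg_def S_def)
    then have "R_words k \<epsilon> (lang X k) (lang Y k) (marg \<mu> k) \<le> ereal (real r)"
      unfolding R_words_def by (intro Inf_lower) auto
    also have "real r \<le> q * k"
      unfolding r_def using q by (simp add: of_nat_floor)
    then have "ereal (real r) \<le> ereal (real k) * ereal q"
      by (simp add: mult.commute)
    finally show ?case
      using elim by (simp add: ereal_divide_le_pos)
  qed
  then have "R_eps X Y \<mu> \<epsilon> \<le> ereal q"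
    unfolding R_eps_def by (intro Liminf_le) auto
  then show "R_eps X Y \<mu> \<epsilon> \<le> ereal (measure \<nu> mismatch) + ereal d"
    by (simp add: q_def)
qed

end

section \<open>The limit for vanishing error probability\<close>

lemma R_eps_antimono:
  assumes "\<epsilon> \<le> \<epsilon>'" shows "R_eps X Y \<mu> \<epsilon>' \<le> R_eps X Y \<mu> \<epsilon>"
  unfolding R_eps_def
proof (rule Liminf_mono, rule eventually_mono[OF eventually_gt_at_top[of 0]])
  fix n :: nat assume "0 < n"
  have "R_words n \<epsilon>' C A \<eta> \<le> R_words n \<epsilon> C A \<eta>" for C A :: "'a list set" and \<eta>
    unfolding R_words_def using assms by (intro Inf_superset_mono) force
  then show "R_words n \<epsilon>' (lang X n) (lang Y n) (marg \<mu> n) / ereal (real n)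
      \<le> R_words n \<epsilon> (lang X n) (lang Y n) (marg \<mu> n) / ereal (real n)"
    using \<open>0 < n\<close> by (intro ereal_divide_right_mono) auto
qed

text \<open>\<open>R_eps\<close> can only grow as \<open>\<epsilon>\<close> decreases, so the
  right-hand limit at zero exists and \<open>Lim\<close> denotes it; as a supremum it can be
  compared level by level.\<close>

lemma ess_cov_radius_eq_SUP: "ess_cov_radius X Y \<mu> = (SUP \<epsilon>\<in>{0<..}. R_eps X Y \<mu> \<epsilon>)"
proof -
  have "((\<lambda>\<epsilon>. R_eps X Y \<mu> \<epsilon>) \<longlongrightarrow> (SUP \<epsilon>\<in>{0<..}. R_eps X Y \<mu> \<epsilon>)) (at_right 0)"
  proof (rule order_tendstoI)
    fix a assume "a < (SUP \<epsilon>\<in>{0<..}. R_eps X Y \<mu> \<epsilon>)"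
    then obtain e where e: "0 < e" "a < R_eps X Y \<mu> e" by (auto simp: less_SUP_iff)
    have "\<forall>\<^sub>F \<epsilon> in at_right 0. \<epsilon> < e"
      using e(1) eventually_at_right_real[OF e(1)] by (auto elim: eventually_mono)
    then show "\<forall>\<^sub>F \<epsilon> in at_right 0. a < R_eps X Y \<mu> \<epsilon>"
      by eventually_elim (use e R_eps_antimono in \<open>metis less_imp_le order_less_le_trans\<close>)
  next
    fix a assume a: "(SUP \<epsilon>\<in>{0<..}. R_eps X Y \<mu> \<epsilon>) < a"
    show "\<forall>\<^sub>F \<epsilon> in at_right 0. R_eps X Y \<mu> \<epsilon> < a"
      using eventually_at_right_less[of "0::real"]
    proof eventually_elim
      case (elim \<epsilon>)
      then have "R_eps X Y \<mu> \<epsilon> \<le> (SUP \<epsilon>\<in>{0<..}. R_eps X Y \<mu> \<epsilon>)" by (intro SUP_upper) auto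
      with a show ?case by simp
    qed
  qed
  then show ?thesis
    unfolding ess_cov_radius_def by (intro tendsto_Lim) auto
qed

theorem theorem24:
  fixes X Y :: "(int \<Rightarrow> 'a::finite) set" and \<mu> :: "(int \<Rightarrow> 'a) measure"
  assumes "constrained_system X" and "constrained_system Y"
    and "sets \<mu> = sets seq_space" and "prob_space \<mu>" and "emeasure \<mu> Y = 1"
    and "ergodic_measure \<mu> shift"
  shows "ess_cov_radius X Y \<mu> =
           (INF \<nu>\<in>ergodic_couplings X Y \<mu>. ereal (measure \<nu> {(x, y). (x, y) \<in> X \<times> Y \<and> x 0 \<noteq> y 0}))
       \<and> (INF \<nu>\<in>ergodic_couplings X Y \<mu>. ereal (measure \<nu> {(x, y). (x, y) \<in> X \<times> Y \<and> x 0 \<noteq> y 0}))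
         = (INF \<nu>\<in>couplings X Y \<mu>. ereal (measure \<nu> {(x, y). (x, y) \<in> X \<times> Y \<and> x 0 \<noteq> y 0}))"
proof -
  interpret coupling_setting X Y \<mu> by (rule coupling_setting.intro) (rule assms)+
  let ?f = "\<lambda>\<nu>. ereal (measure \<nu> mismatch)"
  let ?g = "\<lambda>\<nu>. ereal (measure \<nu> {(x, y). (x, y) \<in> X \<times> Y \<and> x 0 \<noteq> y 0})"
  have sub: "ergodic_couplings X Y \<mu> \<subseteq> couplings X Y \<mu>" by (auto simp: ergodic_couplings_def)
  have M: "(INF \<nu>\<in>couplings X Y \<mu>. ?g \<nu>) = (INF \<nu>\<in>couplings X Y \<mu>. ?f \<nu>)"
    by (intro INF_cong refl arg_cong[where f = ereal] measure_mismatch)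
  have E: "(INF \<nu>\<in>ergodic_couplings X Y \<mu>. ?g \<nu>) = (INF \<nu>\<in>ergodic_couplings X Y \<mu>. ?f \<nu>)"
    by (intro INF_cong refl arg_cong[where f = ereal] measure_mismatch subsetD[OF sub])
  have 1: "(INF \<nu>\<in>couplings X Y \<mu>. ?f \<nu>) \<le> ess_cov_radius X Y \<mu>"
  \<comment> \<open>Comparing with every \<open>c'\<close> above the radius also covers an infinite
    radius, as when \<open>X\<close> is empty: then there is no such \<open>c'\<close>. A finite
    \<open>c'\<close> bounds all \<open>R_eps\<close> strictly, as the construction of a coupling
    requires.\<close>
  proof (rule dense_ge)
    fix c' assume c': "ess_cov_radius X Y \<mu> < c'"
    show "(INF \<nu>\<in>couplings X Y \<mu>. ?f \<nu>) \<le> c'"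
    proof (cases c')
      case (real c)
      have "R_eps X Y \<mu> \<epsilon> < ereal c" if "0 < \<epsilon>" for \<epsilon>
        using c' that SUP_upper[of \<epsilon> "{0<..}" "R_eps X Y \<mu>"]
        unfolding real ess_cov_radius_eq_SUP by (simp add: order_le_less_trans)
      then obtain \<nu> where "\<nu> \<in> couplings X Y \<mu>" "measure \<nu> mismatch \<le> c"
        using coupling_from_R_eps by blast
      then show ?thesis unfolding real by (intro INF_lower2) auto
    qed (use c' in auto)
  qed
  have 2: "ess_cov_radius X Y \<mu> \<le> (INF \<nu>\<in>ergodic_couplings X Y \<mu>. ?f \<nu>)"
    unfolding ess_cov_radius_eq_SUP by (intro SUP_least INF_greatest R_eps_le_ergodic) auto
  have 3: "(INF \<nu>\<in>ergodic_couplings X Y \<mu>. ?f \<nu>) \<le> (INF \<nu>\<in>couplings X Y \<mu>. ?f \<nu>)"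
  proof (rule INF_mono)
    fix \<nu>\<^sub>0 assume "\<nu>\<^sub>0 \<in> couplings X Y \<mu>"
    then obtain \<nu> where "\<nu> \<in> ergodic_couplings X Y \<mu>" "measure \<nu> mismatch \<le> measure \<nu>\<^sub>0 mismatch"
      using ergodic_coupling_le by blast
    then show "\<exists>\<nu>\<in>ergodic_couplings X Y \<mu>. ?f \<nu> \<le> ?f \<nu>\<^sub>0" by auto
  qed
  \<comment> \<open>The three inequalities form a cycle through the radius and the two infima, so
    all are equalities.\<close>
  show ?thesis
    unfolding M E by (intro conjI antisym 2 3 order_trans[OF 3 1] order_trans[OF 1 2])
qed

end
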